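(* Let $T=[t_1,t_2]$ and let $(P_t)_{t\in T}$ with densities $p(\cdot,t)$ with respect to a $\sigma$-finite measure $\nu$ satisfy: $p$ is measurable, $t\mapsto p(x,t)$ is absolutely continuous for $\nu$-a.e. $x$, the Fisher information $\mathcal{I}(t):=\int_{\mathcal{X}}(\partial_t p(x,t))^2/p(x,t)\,d\nu(x)$ is finite for all $t$ with $\int_T\mathcal{I}<\infty$, and $\mathcal{I}$ is absolutely continuous on $T$. Let $p,q>1$ with $1/p+1/q=1$, and let $\rho_t(x):=\partial_t p(x,t)/p(x,t)$ be such that $t\mapsto\mathbb{E}_{P_t}[|\rho_t(\boldsymbol{X})|^q]$ is finite and integrable over $T$. Let $\mathcal{A}$ be the class of functions $\alpha:T\to\mathbb{R}$ that are absolutely continuous with weak derivative $\alpha'$ such that $(\alpha')^2$ is absolutely continuous, and satisfy $\alpha(t_1)=\alpha(t_2)=0$. Then for every measurable $\hat t:\mathcal{X}\to\mathbb{R}$, $$\sup_{t\in T}\mathbb{E}_{P_t}\bigl[|\hat t(\boldsymbol{X})-t|^p\bigr]\ge\sup_{\alpha\in\mathcal{A}}\left(\frac{\bigl|\int_T\alpha(t)\,dt\bigr|}{\int_T\bigl\{\mathbb{E}_{P_t}\bigl[|\alpha'(t)+\alpha(t)\rho_t(\boldsymbol{X})|^q\bigr]\bigr\}^{1/q}dt}\right)^p.$$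
   Context: $\mathbb{E}_{P_t}$ denotes expectation with $\boldsymbol{X}\sim P_t$. *)

theory Defs
  imports "HOL-Analysis.Analysis"
begin

definition abs_cont_on :: "real \<Rightarrow> real \<Rightarrow> (real \<Rightarrow> real) \<Rightarrow> bool" where
  "abs_cont_on a b f \<longleftrightarrow>
     (\<forall>\<epsilon>>0. \<exists>\<delta>>0. \<forall>(n::nat) (l::nat \<Rightarrow> real) (u::nat \<Rightarrow> real).
        (\<forall>i<n. a \<le> l i \<and> l i \<le> u i \<and> u i \<le> b) \<longrightarrow>
        (\<forall>i<n. \<forall>j<n. i \<noteq> j \<longrightarrow> u i \<le> l j \<or> u j \<le> l i) \<longrightarrow>
        (\<Sum>i<n. u i - l i) < \<delta> \<longrightarrow>
        (\<Sum>i<n. \<bar>f (u i) - f (l i)\<bar>) < \<epsilon>)"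

definition weak_deriv_on :: "real \<Rightarrow> real \<Rightarrow> (real \<Rightarrow> real) \<Rightarrow> (real \<Rightarrow> real) \<Rightarrow> bool" where
  "weak_deriv_on a b f f' \<longleftrightarrow>
     f' integrable_on {a..b} \<and> (\<forall>t\<in>{a..b}. f t = f a + integral {a..t} f')"

definition dt_dens :: "('x \<Rightarrow> real \<Rightarrow> real) \<Rightarrow> real \<Rightarrow> real \<Rightarrow> 'x \<Rightarrow> real \<Rightarrow> real" where
  "dt_dens p t1 t2 x t =
     (if p x differentiable (at t within {t1..t2})
      then vector_derivative (p x) (at t within {t1..t2}) else 0)"

text \<open>Score rho_t(x) = d_t p(x,t) / p(x,t) (division by 0 gives 0).\<close>
definition score :: "('x \<Rightarrow> real \<Rightarrow> real) \<Rightarrow> real \<Rightarrow> real \<Rightarrow> 'x \<Rightarrow> real \<Rightarrow> real" where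
  "score p t1 t2 x t = dt_dens p t1 t2 x t / p x t"

definition fisher_info :: "'x measure \<Rightarrow> ('x \<Rightarrow> real \<Rightarrow> real) \<Rightarrow> real \<Rightarrow> real \<Rightarrow> real \<Rightarrow> real" where
  "fisher_info nu p t1 t2 t = (\<integral>x. (dt_dens p t1 t2 x t)\<^sup>2 / p x t \<partial>nu)"

definition expect_t :: "'x measure \<Rightarrow> ('x \<Rightarrow> real \<Rightarrow> real) \<Rightarrow> real \<Rightarrow> ('x \<Rightarrow> real) \<Rightarrow> real" where
  "expect_t nu p t f = (\<integral>x. f x * p x t \<partial>nu)"

definition adm_class :: "real \<Rightarrow> real \<Rightarrow> ((real \<Rightarrow> real) \<times> (real \<Rightarrow> real)) set" where
  "adm_class t1 t2 = {(a, a'). abs_cont_on t1 t2 a \<and> weak_deriv_on t1 t2 a a' \<and>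
      abs_cont_on t1 t2 (\<lambda>t. (a' t)\<^sup>2) \<and> a t1 = 0 \<and> a t2 = 0}"

end

theory Submission
  imports Defs
begin

text \<open>
  For almost every \<open>x\<close> the function \<open>t \<mapsto> (that(x) - t) \<alpha>(t) p(x,t)\<close> is absolutely continuous and
  vanishes at both ends of \<open>T\<close>, so its derivative integrates to \<open>0\<close>:
  the integral of \<open>\<alpha>(t) p(x,t)\<close> over \<open>T\<close> equals that of
  \<open>(that(x) - t) (\<alpha>'(t) + \<alpha>(t) \<rho>\<^sub>t(x)) p(x,t)\<close>. Integrating over \<open>x\<close>, exchanging the order of
  integration and applying Hoelder's inequality for each fixed \<open>t\<close> gives the bound.

  The analytic input is Lebesgue's theorem that an absolutely continuous function is almost
  everywhere differentiable and is the integral of its derivative. A monotone absolutely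
  continuous function induces a Stieltjes measure that is absolutely continuous with respect to
  Lebesgue measure, so the Radon-Nikodym theorem provides a density; Jordan decomposition reduces
  the general case to this one, and Lebesgue's differentiation theorem identifies the density with
  the derivative.
\<close>

section \<open>Absolutely continuous functions and their variation\<close>

text \<open>The delicate point is the exchange of the order of integration. The product rule and the
  boundary values are used for almost every fixed \<open>x\<close>, Hoelder's inequality for almost
  every fixed \<open>t\<close>, and the two meet only through a jointly measurable function on the
  product space. Neither \<open>dt_dens\<close>, a pointwise derivative with a default value, nor
  \<open>a'\<close>, given as a gauge integrable function, is of that kind at sight. The derivative
  is therefore replaced by a limit of difference quotients and \<open>a'\<close> by a Borel
  function, each equal to the original almost everywhere where it matters; the score itself appears
  only at fixed \<open>t\<close>. Integrability on the product space is a consequence of the Hoelder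
  bound, so that estimate has to precede the appeal to Fubini.\<close>

definition nonoverlapping :: "real \<Rightarrow> real \<Rightarrow> 'i set \<Rightarrow> ('i \<Rightarrow> real) \<Rightarrow> ('i \<Rightarrow> real) \<Rightarrow> bool" where
  "nonoverlapping a b I l u \<longleftrightarrow> finite I \<and> (\<forall>i\<in>I. a \<le> l i \<and> l i \<le> u i \<and> u i \<le> b) \<and>
     (\<forall>i\<in>I. \<forall>j\<in>I. i \<noteq> j \<longrightarrow> u i \<le> l j \<or> u j \<le> l i)"

lemma nonoverlappingD:
  "nonoverlapping a b I l u \<Longrightarrow> i \<in> I \<Longrightarrow> a \<le> l i \<and> l i \<le> u i \<and> u i \<le> b"
  by (simp add: nonoverlapping_def)

lemma abs_cont_on_iff:
  "abs_cont_on a b f \<longleftrightarrow> (\<forall>\<epsilon>>0. \<exists>\<delta>>0. \<forall>(n::nat) l u. nonoverlapping a b {..<n} l u \<longrightarrow>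
     (\<Sum>i<n. u i - l i) < \<delta> \<longrightarrow> (\<Sum>i<n. \<bar>f (u i) - f (l i)\<bar>) < \<epsilon>)"
  by (simp add: abs_cont_on_def nonoverlapping_def Ball_def imp_conjL)

text \<open>Numbering a finite index set carries the estimate over. Later families have natural
  labels other than initial segments: pairs (interval, subinterval) for the variation, and the
  members of a covering for the Stieltjes measure.\<close>

lemma abs_cont_on_finite_family:
  assumes "abs_cont_on a b f" "\<epsilon> > 0"
  shows "\<exists>\<delta>>0. \<forall>(I::'i set) l u. nonoverlapping a b I l u \<longrightarrow>
       (\<Sum>i\<in>I. u i - l i) < \<delta> \<longrightarrow> (\<Sum>i\<in>I. \<bar>f (u i) - f (l i)\<bar>) < \<epsilon>"
proof -
  obtain \<delta> where d: "\<delta> > 0" and D: "\<forall>(n::nat) l u. nonoverlapping a b {..<n} l u \<longrightarrow>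
        (\<Sum>i<n. u i - l i) < \<delta> \<longrightarrow> (\<Sum>i<n. \<bar>f (u i) - f (l i)\<bar>) < \<epsilon>"
    using assms(1)[unfolded abs_cont_on_iff, rule_format, OF assms(2)] by (elim exE conjE)
  show ?thesis
  proof (intro exI[of _ \<delta>] conjI allI impI d)
    fix I :: "'i set" and l u
    assume no: "nonoverlapping a b I l u" and 3: "(\<Sum>i\<in>I. u i - l i) < \<delta>"
    obtain h where "bij_betw h {0..<card I} I"
      using ex_bij_betw_nat_finite[of I] no[unfolded nonoverlapping_def, THEN conjunct1] by blast
    then have h: "bij_betw h {..<card I} I" by (simp add: atLeast0LessThan)
    have hI: "h i \<in> I" if "i < card I" for i
      using bij_betwE[OF h] that by simp
    have hne: "h i \<noteq> h j" if "i < card I" "j < card I" "i \<noteq> j" for i j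
      using inj_onD[OF bij_betw_imp_inj_on[OF h], of i j] that by auto
    have "nonoverlapping a b {..<card I} (l \<circ> h) (u \<circ> h)"
      using no hI hne by (simp add: nonoverlapping_def)
    moreover have "(\<Sum>i<card I. (u \<circ> h) i - (l \<circ> h) i) < \<delta>"
      using 3 sum.reindex_bij_betw[OF h, of "\<lambda>i. u i - l i"] by simp
    ultimately have "(\<Sum>i<card I. \<bar>f ((u \<circ> h) i) - f ((l \<circ> h) i)\<bar>) < \<epsilon>"
      by (rule D[rule_format])
    then show "(\<Sum>i\<in>I. \<bar>f (u i) - f (l i)\<bar>) < \<epsilon>"
      using sum.reindex_bij_betw[OF h, of "\<lambda>i. \<bar>f (u i) - f (l i)\<bar>"] by simp
  qed
qed

lemma abs_cont_on_imp_uniform: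
  assumes "abs_cont_on a b f" "\<epsilon> > 0"
  shows "\<exists>\<delta>>0. \<forall>s\<in>{a..b}. \<forall>t\<in>{a..b}. \<bar>t - s\<bar> < \<delta> \<longrightarrow> \<bar>f t - f s\<bar> < \<epsilon>"
proof -
  obtain \<delta> where d: "\<delta> > 0" and D: "\<forall>(I::unit set) l u. nonoverlapping a b I l u \<longrightarrow>
       (\<Sum>i\<in>I. u i - l i) < \<delta> \<longrightarrow> (\<Sum>i\<in>I. \<bar>f (u i) - f (l i)\<bar>) < \<epsilon>"
    using abs_cont_on_finite_family[OF assms, where 'i=unit] by (elim exE conjE)
  have up: "\<bar>f t - f s\<bar> < \<epsilon>" if "a \<le> s" "s \<le> t" "t \<le> b" "t - s < \<delta>" for s t
    using D[rule_format, of UNIV "\<lambda>_. s" "\<lambda>_. t"] that by (simp add: nonoverlapping_def)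
  show ?thesis
  proof (intro exI[of _ \<delta>] conjI ballI impI d)
    fix s t assume "s \<in> {a..b}" "t \<in> {a..b}" "\<bar>t - s\<bar> < \<delta>"
    then show "\<bar>f t - f s\<bar> < \<epsilon>"
      using up[of s t] up[of t s] by (cases "s \<le> t") (auto simp: abs_minus_commute)
  qed
qed

lemma abs_cont_on_imp_continuous_on:
  assumes "abs_cont_on a b f"
  shows "continuous_on {a..b} f"
  unfolding continuous_on_iff dist_real_def
  using abs_cont_on_imp_uniform[OF assms] by (meson atLeastAtMost_iff)

lemma abs_cont_on_imp_bounded:
  assumes "abs_cont_on a b f"
  obtains B where "B > 0" "\<And>t. t \<in> {a..b} \<Longrightarrow> \<bar>f t\<bar> \<le> B"
proof -
  have "bounded (f ` {a..b})"
    using compact_imp_bounded compact_continuous_image[OF abs_cont_on_imp_continuous_on[OF assms]] by blast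
  then obtain B where "B > 0" "\<forall>x\<in>f ` {a..b}. norm x \<le> B"
    using bounded_pos by blast
  then show thesis using that by auto
qed

section \<open>Closure properties of absolute continuity\<close>

lemma abs_cont_on_add:
  assumes f: "abs_cont_on a b f" and g: "abs_cont_on a b g"
  shows "abs_cont_on a b (\<lambda>t. f t + g t)"
  unfolding abs_cont_on_iff
proof (intro allI impI)
  fix \<epsilon> :: real assume "\<epsilon> > 0"
  then have e: "\<epsilon>/2 > 0" by simp
  obtain d1 where d1: "d1 > 0" and D1: "\<forall>(n::nat) l u. nonoverlapping a b {..<n} l u \<longrightarrow>
       (\<Sum>i<n. u i - l i) < d1 \<longrightarrow> (\<Sum>i<n. \<bar>f (u i) - f (l i)\<bar>) < \<epsilon>/2"
    using f[unfolded abs_cont_on_iff, rule_format, OF e] by (elim exE conjE)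
  obtain d2 where d2: "d2 > 0" and D2: "\<forall>(n::nat) l u. nonoverlapping a b {..<n} l u \<longrightarrow>
       (\<Sum>i<n. u i - l i) < d2 \<longrightarrow> (\<Sum>i<n. \<bar>g (u i) - g (l i)\<bar>) < \<epsilon>/2"
    using g[unfolded abs_cont_on_iff, rule_format, OF e] by (elim exE conjE)
  show "\<exists>\<delta>>0. \<forall>(n::nat) l u. nonoverlapping a b {..<n} l u \<longrightarrow> (\<Sum>i<n. u i - l i) < \<delta> \<longrightarrow>
        (\<Sum>i<n. \<bar>(f (u i) + g (u i)) - (f (l i) + g (l i))\<bar>) < \<epsilon>"
  proof (intro exI[of _ "min d1 d2"] conjI allI impI)
    show "0 < min d1 d2" using d1 d2 by simp
    fix n :: nat and l u
    assume A: "nonoverlapping a b {..<n} l u" "(\<Sum>i<n. u i - l i) < min d1 d2"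
    have "(\<Sum>i<n. \<bar>(f (u i) + g (u i)) - (f (l i) + g (l i))\<bar>)
      \<le> (\<Sum>i<n. \<bar>f (u i) - f (l i)\<bar> + \<bar>g (u i) - g (l i)\<bar>)"
      by (intro sum_mono) linarith
    also have "\<dots> < \<epsilon>/2 + \<epsilon>/2"
      unfolding sum.distrib using A
      by (intro add_strict_mono D1[rule_format, OF A(1)] D2[rule_format, OF A(1)]) auto
    finally show "(\<Sum>i<n. \<bar>(f (u i) + g (u i)) - (f (l i) + g (l i))\<bar>) < \<epsilon>" by simp
  qed
qed

text \<open>The tolerance \<epsilon>/C for \<open>f\<close> serves \<epsilon> for \<open>g\<close>.
  Scalar multiples, squares (through a bound on \<open>f\<close>) and \<open>c - t\<close> all
  reduce to this comparison.\<close>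

lemma abs_cont_on_dominated:
  assumes f: "abs_cont_on a b f" and C: "C > 0"
    and le: "\<And>s t. s \<in> {a..b} \<Longrightarrow> t \<in> {a..b} \<Longrightarrow> \<bar>g t - g s\<bar> \<le> C * \<bar>f t - f s\<bar>"
  shows "abs_cont_on a b g"
  unfolding abs_cont_on_iff
proof (intro allI impI)
  fix \<epsilon> :: real assume "\<epsilon> > 0"
  then have e: "\<epsilon>/C > 0" using C by simp
  obtain d1 where d1: "d1 > 0" and D1: "\<forall>(n::nat) l u. nonoverlapping a b {..<n} l u \<longrightarrow>
       (\<Sum>i<n. u i - l i) < d1 \<longrightarrow> (\<Sum>i<n. \<bar>f (u i) - f (l i)\<bar>) < \<epsilon>/C"
    using f[unfolded abs_cont_on_iff, rule_format, OF e] by (elim exE conjE)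
  show "\<exists>\<delta>>0. \<forall>(n::nat) l u. nonoverlapping a b {..<n} l u \<longrightarrow>
        (\<Sum>i<n. u i - l i) < \<delta> \<longrightarrow> (\<Sum>i<n. \<bar>g (u i) - g (l i)\<bar>) < \<epsilon>"
  proof (intro exI[of _ d1] conjI allI impI d1)
    fix n :: nat and l u
    assume A: "nonoverlapping a b {..<n} l u" "(\<Sum>i<n. u i - l i) < d1"
    have "(\<Sum>i<n. \<bar>g (u i) - g (l i)\<bar>) \<le> (\<Sum>i<n. C * \<bar>f (u i) - f (l i)\<bar>)"
      using nonoverlappingD[OF A(1)] by (intro sum_mono le) force+
    also have "\<dots> = C * (\<Sum>i<n. \<bar>f (u i) - f (l i)\<bar>)"
      by (simp add: sum_distrib_left)
    also have "\<dots> < C * (\<epsilon>/C)"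
      using A C by (intro mult_strict_left_mono D1[rule_format]) auto
    finally show "(\<Sum>i<n. \<bar>g (u i) - g (l i)\<bar>) < \<epsilon>" using C by simp
  qed
qed

lemma abs_cont_on_ident: "abs_cont_on a b (\<lambda>t. t)"
  unfolding abs_cont_on_def by (intro allI impI exI conjI) auto

lemma abs_cont_on_cmult:
  assumes "abs_cont_on a b f"
  shows "abs_cont_on a b (\<lambda>t. c * f t)"
proof (rule abs_cont_on_dominated[OF assms, of "\<bar>c\<bar> + 1"])
  fix s t
  have "\<bar>c * f t - c * f s\<bar> = \<bar>c\<bar> * \<bar>f t - f s\<bar>"
    by (metis abs_mult right_diff_distrib)
  then show "\<bar>c * f t - c * f s\<bar> \<le> (\<bar>c\<bar> + 1) * \<bar>f t - f s\<bar>"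
    by (simp add: distrib_right)
qed simp

lemma abs_cont_on_power2:
  assumes "abs_cont_on a b f"
  shows "abs_cont_on a b (\<lambda>t. (f t)\<^sup>2)"
proof -
  obtain B where B: "B > 0" "\<And>t. t \<in> {a..b} \<Longrightarrow> \<bar>f t\<bar> \<le> B"
    using abs_cont_on_imp_bounded[OF assms] by metis
  show ?thesis
  proof (rule abs_cont_on_dominated[OF assms, of "2 * B"])
    fix s t assume st: "s \<in> {a..b}" "t \<in> {a..b}"
    have "(f t)\<^sup>2 - (f s)\<^sup>2 = (f t + f s) * (f t - f s)"
      by (simp add: power2_eq_square algebra_simps)
    then have "\<bar>(f t)\<^sup>2 - (f s)\<^sup>2\<bar> = \<bar>f t + f s\<bar> * \<bar>f t - f s\<bar>"
      by (simp add: abs_mult)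
    also have "\<dots> \<le> (2 * B) * \<bar>f t - f s\<bar>"
      using B(2)[OF st(1)] B(2)[OF st(2)] by (intro mult_right_mono) linarith+
    finally show "\<bar>(f t)\<^sup>2 - (f s)\<^sup>2\<bar> \<le> (2 * B) * \<bar>f t - f s\<bar>" .
  qed (use B in simp)
qed

lemma abs_cont_on_mult:
  assumes "abs_cont_on a b f" "abs_cont_on a b g"
  shows "abs_cont_on a b (\<lambda>t. f t * g t)"
proof -
  \<comment> \<open>Polarization reduces products to squares.\<close>
  have "(\<lambda>t. f t * g t) = (\<lambda>t. (1/4) * (f t + g t)\<^sup>2 + (- (1/4)) * (f t + (- 1) * g t)\<^sup>2)"
    by (auto simp: power2_eq_square algebra_simps)
  then show ?thesis
    by (simp only:) (intro abs_cont_on_add abs_cont_on_cmult abs_cont_on_power2 assms)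
qed

lemma abs_cont_on_const_minus_ident: "abs_cont_on a b (\<lambda>t. c - t)"
  by (rule abs_cont_on_dominated[OF abs_cont_on_ident, of 1]) auto

section \<open>Total variation and Jordan decomposition\<close>

text \<open>A chain is an infinite monotone sequence of which \<open>n\<close> increments are read,
  and it need not start at \<open>s\<close> or end at \<open>t\<close>. Clipping with
  \<open>min\<close> or \<open>max\<close> thus gives a chain again, while the supremum is still the
  usual total variation, since adding end points only enlarges a sum.\<close>

definition variation_sums :: "(real \<Rightarrow> real) \<Rightarrow> real \<Rightarrow> real \<Rightarrow> real set" where
  "variation_sums f s t =
     {\<Sum>j<n. \<bar>f (x (Suc j)) - f (x j)\<bar> | n x. mono x \<and> range x \<subseteq> {s..t}}"

definition variation :: "(real \<Rightarrow> real) \<Rightarrow> real \<Rightarrow> real \<Rightarrow> real" where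
  "variation f s t = Sup (variation_sums f s t)"

lemma variation_sumsI:
  "mono x \<Longrightarrow> range x \<subseteq> {s..t} \<Longrightarrow> (\<Sum>j<n. \<bar>f (x (Suc j)) - f (x j)\<bar>) \<in> variation_sums f s t"
  unfolding variation_sums_def by blast

lemma variation_sumsE:
  assumes "v \<in> variation_sums f s t"
  obtains n x where "v = (\<Sum>j<n. \<bar>f (x (Suc j)) - f (x j)\<bar>)" "mono x" "\<And>j. s \<le> x j \<and> x j \<le> t"
  using assms unfolding variation_sums_def by force

lemma variation_sums_zero: "s \<le> t \<Longrightarrow> 0 \<in> variation_sums f s t"
  using variation_sumsI[of "\<lambda>_. s" s t f 0] by (auto simp: mono_def)

text \<open>Truncating a monotone sequence at an intermediate point \<open>r\<close> from above and from below
  splits it into monotone sequences on both sides of \<open>r\<close>.\<close>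
lemma variation_sums_split:
  assumes v: "v \<in> variation_sums f s t" and r: "s \<le> r" "r \<le> t"
  obtains v1 v2 where "v1 \<in> variation_sums f s r" "v2 \<in> variation_sums f r t" "v \<le> v1 + v2"
proof -
  obtain n x where v: "v = (\<Sum>j<n. \<bar>f (x (Suc j)) - f (x j)\<bar>)" and x: "mono x" "\<And>j. s \<le> x j \<and> x j \<le> t"
    using v by (rule variation_sumsE) blast
  define y where "y j = min (x j) r" for j
  define z where "z j = max (x j) r" for j
  have y: "mono y" "range y \<subseteq> {s..r}"
    using x r by (auto simp: y_def mono_def min.coboundedI1)
  have z: "mono z" "range z \<subseteq> {r..t}"
    using x r by (auto simp: z_def mono_def max.coboundedI1)
  have "v \<le> (\<Sum>j<n. \<bar>f (y (Suc j)) - f (y j)\<bar> + \<bar>f (z (Suc j)) - f (z j)\<bar>)"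
    unfolding v
  proof (rule sum_mono)
    fix j
    \<comment> \<open>An increment on one side of \<open>r\<close> survives in one chain and is zero
      in the other; one that straddles \<open>r\<close> is split at \<open>f r\<close> by the
      triangle inequality.\<close>
    have "x j \<le> x (Suc j)" using x(1) by (simp add: mono_def)
    then show "\<bar>f (x (Suc j)) - f (x j)\<bar>
      \<le> \<bar>f (y (Suc j)) - f (y j)\<bar> + \<bar>f (z (Suc j)) - f (z j)\<bar>"
      by (auto simp: y_def z_def min_def max_def)
  qed
  then show thesis
    by (intro that[OF variation_sumsI[OF y, of f n] variation_sumsI[OF z, of f n]])
      (simp add: sum.distrib)
qed

lemma variation_sums_append:
  assumes v: "v \<in> variation_sums f s r" and r: "r \<le> t"
  obtains w where "w \<in> variation_sums f s t" "v + \<bar>f t - f r\<bar> \<le> w"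
proof -
  obtain n x where v: "v = (\<Sum>j<n. \<bar>f (x (Suc j)) - f (x j)\<bar>)" and x: "mono x" "\<And>j. s \<le> x j \<and> x j \<le> r"
    using v by (rule variation_sumsE) blast
  \<comment> \<open>Of the \<open>n + 2\<close> increments read, the first \<open>n\<close>
    reproduce \<open>v\<close>, the one from \<open>x n\<close> to \<open>r\<close> is dropped as
    nonnegative, and the last is the wanted |f t - f r|.\<close>
  define y where "y j = (if j \<le> n then x j else if j = Suc n then r else t)" for j
  have y: "mono y" "range y \<subseteq> {s..t}"
  proof -
    have xt: "s \<le> x j" "x j \<le> r" "x j \<le> t" "s \<le> r" "s \<le> t" for j
      using x(2)[of j] r by auto
    then show "range y \<subseteq> {s..t}" using r by (auto simp: y_def)
    have "y j \<le> y (Suc j)" for j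
    proof -
      consider "Suc j \<le> n" | "j = n" | "j = Suc n" | "j > Suc n" by linarith
      then show ?thesis
        by cases (simp_all add: y_def xt(2) r monoD[OF x(1)])
    qed
    then show "mono y" by (simp add: mono_iff_le_Suc)
  qed
  have "(\<Sum>j<n. \<bar>f (y (Suc j)) - f (y j)\<bar>) = v"
    unfolding v by (rule sum.cong) (auto simp: y_def)
  then have "v + \<bar>f t - f r\<bar> \<le> (\<Sum>j<Suc (Suc n). \<bar>f (y (Suc j)) - f (y j)\<bar>)"
    by (simp add: y_def)
  then show thesis by (rule that[OF variation_sumsI[OF y]])
qed

text \<open>Cutting each interval along its own chain gives a nonoverlapping family of pairs whose
  lengths telescope to at most the original total. So the \<delta> of \<open>f\<close> controls
  chain sums and not only end-point increments.\<close>

lemma abs_cont_on_family_variation: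
  assumes f: "abs_cont_on a b f" and e: "\<epsilon> > 0"
  shows "\<exists>\<delta>>0. \<forall>(n::nat) l u v. nonoverlapping a b {..<n} l u \<longrightarrow>
       (\<Sum>i<n. u i - l i) < \<delta> \<longrightarrow> (\<forall>i<n. v i \<in> variation_sums f (l i) (u i)) \<longrightarrow> (\<Sum>i<n. v i) < \<epsilon>"
proof -
  obtain \<delta> where d: "\<delta> > 0" and D: "\<forall>(I::(nat \<times> nat) set) l u. nonoverlapping a b I l u \<longrightarrow>
       (\<Sum>i\<in>I. u i - l i) < \<delta> \<longrightarrow> (\<Sum>i\<in>I. \<bar>f (u i) - f (l i)\<bar>) < \<epsilon>"
    using abs_cont_on_finite_family[OF f e, where 'i="nat \<times> nat"] by (elim exE conjE)
  show ?thesis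
  proof (intro exI[of _ \<delta>] conjI allI impI d)
    fix n :: nat and l u v
    assume no: "nonoverlapping a b {..<n} l u"
      and 3: "(\<Sum>i<n. u i - l i) < \<delta>" and 4: "\<forall>i<n. v i \<in> variation_sums f (l i) (u i)"
    have 1: "a \<le> l i \<and> l i \<le> u i \<and> u i \<le> b" if "i < n" for i
      using nonoverlappingD[OF no] that by simp
    have 2: "u i \<le> l j \<or> u j \<le> l i" if "i < n" "j < n" "i \<noteq> j" for i j
      using no that by (simp add: nonoverlapping_def)
    define good where "good i m x \<longleftrightarrow> v i = (\<Sum>j<m. \<bar>f (x (Suc j)) - f (x j)\<bar>) \<and>
      mono x \<and> (\<forall>j. l i \<le> x j \<and> x j \<le> u i)" for i m and x :: "nat \<Rightarrow> real"
    have "\<exists>m x. good i m x" if "i < n" for i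
      unfolding good_def using 4[rule_format, OF that] by (rule variation_sumsE) blast
    then obtain m x where "\<And>i. i < n \<Longrightarrow> good i (m i) (x i)"
      by metis
    then have mx: "\<And>i. i < n \<Longrightarrow> v i = (\<Sum>j<m i. \<bar>f (x i (Suc j)) - f (x i j)\<bar>)"
        "\<And>i. i < n \<Longrightarrow> mono (x i :: nat \<Rightarrow> real)"
        "\<And>i j. i < n \<Longrightarrow> l i \<le> x i j \<and> x i j \<le> u i"
      by (simp_all add: good_def)
    define I where "I = Sigma {..<n} (\<lambda>i. {..<m i})"
    define L where "L = (\<lambda>(i, j). x i j)"
    define U where "U = (\<lambda>(i, j). x i (Suc j))"
    have "(\<Sum>k\<in>I. U k - L k) = (\<Sum>i<n. \<Sum>j<m i. x i (Suc j) - x i j)"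
      unfolding I_def by (subst sum.Sigma) (auto simp: U_def L_def case_prod_unfold)
    also have "\<dots> = (\<Sum>i<n. x i (m i) - x i 0)"
      by (simp add: sum_lessThan_telescope)
    also have "\<dots> \<le> (\<Sum>i<n. u i - l i)"
      using mx(3) by (intro sum_mono diff_mono) auto
    finally have len: "(\<Sum>k\<in>I. U k - L k) < \<delta>" using 3 by simp
    have "(\<Sum>k\<in>I. \<bar>f (U k) - f (L k)\<bar>) < \<epsilon>"
    proof (rule D[rule_format, OF _ len], unfold nonoverlapping_def, intro conjI ballI impI)
      show "finite I" by (simp add: I_def)
      fix k assume "k \<in> I"
      then obtain i j where k: "k = (i, j)" "i < n" by (auto simp: I_def)
      show "a \<le> L k" "L k \<le> U k" "U k \<le> b"
        using 1[OF k(2)] mx(2)[OF k(2)] mx(3)[OF k(2), of j] mx(3)[OF k(2), of "Suc j"]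
        by (auto simp: k L_def U_def mono_def)
    next
      fix k k' assume kk: "k \<in> I" "k' \<in> I" "k \<noteq> k'"
      show "U k \<le> L k' \<or> U k' \<le> L k"
      proof -
        obtain i j i' j' where k: "k = (i, j)" "k' = (i', j')" by (metis surj_pair)
        have i: "i < n" "i' < n" using kk k by (auto simp: I_def)
        show ?thesis
        proof (cases "i = i'")
          case True
          then have "Suc j \<le> j' \<or> Suc j' \<le> j" using kk k by auto
          then show ?thesis using mx(2)[OF i(1)] True by (auto simp: k L_def U_def mono_def)
        next
          case False
          then have "u i \<le> l i' \<or> u i' \<le> l i" using 2[OF i] by blast
          then show ?thesis
            using mx(3)[OF i(1), of j] mx(3)[OF i(2), of j'] mx(3)[OF i(1), of "Suc j"]
              mx(3)[OF i(2), of "Suc j'"]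
            by (auto simp: k L_def U_def)
        qed
      qed
    qed
    moreover have "(\<Sum>k\<in>I. \<bar>f (U k) - f (L k)\<bar>) = (\<Sum>i<n. v i)"
    proof -
      have "(\<Sum>k\<in>I. \<bar>f (U k) - f (L k)\<bar>) = (\<Sum>i<n. \<Sum>j<m i. \<bar>f (x i (Suc j)) - f (x i j)\<bar>)"
        unfolding I_def by (subst sum.Sigma) (auto simp: U_def L_def case_prod_unfold)
      then show ?thesis using mx(1) by simp
    qed
    ultimately show "(\<Sum>i<n. v i) < \<epsilon>" by simp
  qed
qed

text \<open>On an interval shorter than the \<delta> belonging to \<epsilon> = 1 every chain sum is
  at most 1, and finitely many such intervals make up the whole.\<close>

lemma abs_cont_on_bdd_variation:
  assumes f: "abs_cont_on a b f" and st: "a \<le> s" "t \<le> b"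
  shows "bdd_above (variation_sums f s t)"
proof -
  obtain \<delta> where d: "\<delta> > 0" and D: "\<forall>(n::nat) l u v. nonoverlapping a b {..<n} l u \<longrightarrow>
       (\<Sum>i<n. u i - l i) < \<delta> \<longrightarrow> (\<forall>i<n. v i \<in> variation_sums f (l i) (u i)) \<longrightarrow> (\<Sum>i<n. v i) < 1"
    using abs_cont_on_family_variation[OF f zero_less_one] by (elim exE conjE)
  have small: "v \<le> 1" if "a \<le> s" "s \<le> t" "t \<le> b" "t - s < \<delta>" "v \<in> variation_sums f s t" for s t v
    using D[rule_format, of 1 "\<lambda>_. s" "\<lambda>_. t" "\<lambda>_. v"] that by (simp add: nonoverlapping_def)
  have step: "bdd_above (variation_sums f s t)"
    if "a \<le> s" "s \<le> t" "t \<le> b" "t - s \<le> real k * (\<delta>/2)" for k s t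
    using that
  proof (induction k arbitrary: t)
    case 0
    then show ?case using small[of s t] d by (auto simp: bdd_above_def)
  next
    case (Suc k)
    \<comment> \<open>Steps of length \<delta>/2 stay strictly below \<delta>; \<open>max\<close>
      takes care of a shorter remainder.\<close>
    define r where "r = max s (t - \<delta>/2)"
    have r: "s \<le> r" "r \<le> t" using Suc.prems d by (auto simp: r_def)
    have "r - s \<le> real k * (\<delta>/2)" using Suc.prems d by (auto simp: r_def algebra_simps max_def)
    then obtain B where B: "\<And>v. v \<in> variation_sums f s r \<Longrightarrow> v \<le> B"
      using Suc.IH[of r] r Suc.prems by (auto simp: bdd_above_def)
    have C: "\<And>v. v \<in> variation_sums f r t \<Longrightarrow> v \<le> 1"
      using small[of r t] r Suc.prems d by (auto simp: r_def)
    have "v \<le> B + 1" if v: "v \<in> variation_sums f s t" for v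
      using variation_sums_split[OF v r] B C by (metis add_mono order_trans)
    then show ?case by (auto simp: bdd_above_def)
  qed
  show ?thesis
  proof (cases "s \<le> t")
    case True
    obtain k :: nat where "(t - s) / (\<delta>/2) \<le> real k" using real_arch_simple by blast
    then show ?thesis using step[OF st(1) True st(2), of k] d by (simp add: divide_simps)
  next
    case False
    then have "variation_sums f s t = {}" unfolding variation_sums_def by auto
    then show ?thesis by simp
  qed
qed

lemma variation_subadditive:
  assumes f: "abs_cont_on a b f" and "a \<le> s" "s \<le> r" "r \<le> t" "t \<le> b"
  shows "variation f s t \<le> variation f s r + variation f r t"
  unfolding variation_def
proof (rule cSup_least)
  show "variation_sums f s t \<noteq> {}" using variation_sums_zero[of s t f] assms by auto
  fix v assume "v \<in> variation_sums f s t"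
  then obtain v1 v2 where v: "v1 \<in> variation_sums f s r" "v2 \<in> variation_sums f r t" "v \<le> v1 + v2"
    using assms(3,4) by (rule variation_sums_split)
  have "v1 \<le> Sup (variation_sums f s r)"
    by (rule cSup_upper[OF v(1) abs_cont_on_bdd_variation[OF f]]) (use assms in linarith)+
  moreover have "v2 \<le> Sup (variation_sums f r t)"
    by (rule cSup_upper[OF v(2) abs_cont_on_bdd_variation[OF f]]) (use assms in linarith)+
  ultimately show "v \<le> Sup (variation_sums f s r) + Sup (variation_sums f r t)"
    using v(3) by linarith
qed

text \<open>A chain up to \<open>r\<close> can be prolonged by the step from \<open>r\<close> to
  \<open>t\<close>. The resulting inequality makes both \<open>variation f a\<close> and its
  difference with \<open>f\<close> monotone, which is the Jordan decomposition.\<close>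

lemma variation_increment:
  assumes f: "abs_cont_on a b f" and "a \<le> s" "s \<le> r" "r \<le> t" "t \<le> b"
  shows "variation f s r + \<bar>f t - f r\<bar> \<le> variation f s t"
proof -
  have "variation f s r \<le> variation f s t - \<bar>f t - f r\<bar>"
    unfolding variation_def
  proof (rule cSup_least)
    show "variation_sums f s r \<noteq> {}" using variation_sums_zero[of s r f] assms by auto
    fix v assume "v \<in> variation_sums f s r"
    then obtain w where w: "w \<in> variation_sums f s t" "v + \<bar>f t - f r\<bar> \<le> w"
      using assms(4) by (rule variation_sums_append)
    have "w \<le> Sup (variation_sums f s t)"
      by (rule cSup_upper[OF w(1) abs_cont_on_bdd_variation[OF f]]) (use assms in linarith)+
    then show "v \<le> Sup (variation_sums f s t) - \<bar>f t - f r\<bar>" using w by linarith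
  qed
  then show ?thesis by simp
qed

lemma abs_cont_on_variation:
  assumes f: "abs_cont_on a b f"
  shows "abs_cont_on a b (variation f a)"
  unfolding abs_cont_on_iff
proof (intro allI impI)
  fix \<epsilon> :: real assume e: "\<epsilon> > 0"
  obtain \<delta> where d: "\<delta> > 0" and D: "\<forall>(n::nat) l u v. nonoverlapping a b {..<n} l u \<longrightarrow>
       (\<Sum>i<n. u i - l i) < \<delta> \<longrightarrow> (\<forall>i<n. v i \<in> variation_sums f (l i) (u i)) \<longrightarrow> (\<Sum>i<n. v i) < \<epsilon>/2"
    using abs_cont_on_family_variation[OF f half_gt_zero[OF e]] by (elim exE conjE)
  show "\<exists>\<delta>>0. \<forall>(n::nat) l u. nonoverlapping a b {..<n} l u \<longrightarrow>
        (\<Sum>i<n. u i - l i) < \<delta> \<longrightarrow>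
        (\<Sum>i<n. \<bar>variation f a (u i) - variation f a (l i)\<bar>) < \<epsilon>"
  proof (intro exI[of _ \<delta>] conjI allI impI d)
    fix n :: nat and l u
    assume no: "nonoverlapping a b {..<n} l u" and len: "(\<Sum>i<n. u i - l i) < \<delta>"
    have A: "a \<le> l i \<and> l i \<le> u i \<and> u i \<le> b" if "i < n" for i
      using nonoverlappingD[OF no] that by simp
    \<comment> \<open>Each supremum is replaced by a chain sum at the price \<eta>. The
      \<open>n\<close> errors together cost at most \<epsilon>/2, and \<open>n + 1\<close> in the
      denominator covers \<open>n = 0\<close>.\<close>
    define \<eta> where "\<eta> = \<epsilon> / (2 * (real n + 1))"
    have eta: "\<eta> > 0" "real n * \<eta> \<le> \<epsilon>/2"
      using e by (auto simp: \<eta>_def field_simps)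
    have "\<exists>v\<in>variation_sums f (l i) (u i). variation f (l i) (u i) - \<eta> < v" if "i < n" for i
    proof -
      have "variation_sums f (l i) (u i) \<noteq> {}"
        using variation_sums_zero[of "l i" "u i" f] A that by auto
      moreover have "bdd_above (variation_sums f (l i) (u i))"
        using A that by (auto intro: abs_cont_on_bdd_variation[OF f])
      ultimately show ?thesis
        using less_cSup_iff[of "variation_sums f (l i) (u i)" "variation f (l i) (u i) - \<eta>"] eta
        by (auto simp: variation_def)
    qed
    then obtain v where v: "\<And>i. i < n \<Longrightarrow> v i \<in> variation_sums f (l i) (u i)"
        "\<And>i. i < n \<Longrightarrow> variation f (l i) (u i) < v i + \<eta>"
      by (metis diff_less_eq)
    have "(\<Sum>i<n. \<bar>variation f a (u i) - variation f a (l i)\<bar>) \<le> (\<Sum>i<n. v i + \<eta>)"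
    proof (rule sum_mono)
      fix i assume "i \<in> {..<n}"
      then have i: "i < n" "a \<le> l i" "l i \<le> u i" "u i \<le> b" using A by auto
      have "variation f a (l i) \<le> variation f a (u i)"
        using variation_increment[OF f order_refl i(2,3,4)] by linarith
      moreover have "variation f a (u i) \<le> variation f a (l i) + variation f (l i) (u i)"
        by (rule variation_subadditive[OF f]) (use i in auto)
      ultimately show "\<bar>variation f a (u i) - variation f a (l i)\<bar> \<le> v i + \<eta>"
        using v(2)[OF i(1)] by linarith
    qed
    also have "\<dots> = (\<Sum>i<n. v i) + real n * \<eta>" by (simp add: sum.distrib)
    also have "\<dots> < \<epsilon>/2 + \<epsilon>/2"
      using no len v(1) eta(2) by (intro add_less_le_mono D[rule_format, of n l u]) auto
    finally show "(\<Sum>i<n. \<bar>variation f a (u i) - variation f a (l i)\<bar>) < \<epsilon>" by simp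
  qed
qed

lemma abs_cont_on_mono_decomposition:
  assumes f: "abs_cont_on a b f"
  obtains g h where "abs_cont_on a b g" "abs_cont_on a b h" "mono_on {a..b} g" "mono_on {a..b} h"
    "\<And>t. f t = g t - h t"
proof (rule that[of "variation f a" "\<lambda>t. variation f a t + (- 1) * f t"])
  show V: "abs_cont_on a b (variation f a)" by (rule abs_cont_on_variation[OF f])
  show "abs_cont_on a b (\<lambda>t. variation f a t + (- 1) * f t)"
    by (intro abs_cont_on_add abs_cont_on_cmult V f)
  have inc: "variation f a s + \<bar>f t - f s\<bar> \<le> variation f a t" if "a \<le> s" "s \<le> t" "t \<le> b" for s t
    using variation_increment[OF f order_refl that] .
  show "mono_on {a..b} (variation f a)"
    by (rule mono_onI) (use inc in fastforce)
  show "mono_on {a..b} (\<lambda>t. variation f a t + (- 1) * f t)"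
    by (rule mono_onI) (use inc in fastforce)
qed simp

section \<open>Lebesgue's fundamental theorem of calculus\<close>

text \<open>By outer regularity the null set lies in an open set of length below \<delta>. A
  covering by countably many closed intervals inside that set, with disjoint interiors, turns the
  hypothesis on finite families into a bound for every finite union, and continuity from below
  extends it to the whole covering.\<close>

lemma emeasure_interval_measure_small:
  fixes F :: "real \<Rightarrow> real"
  assumes F: "mono F" "continuous_on UNIV F"
    and \<epsilon>: "\<epsilon> \<ge> 0"
    and fam: "\<And>(I::real set set) l u. finite I \<Longrightarrow> (\<And>i. i \<in> I \<Longrightarrow> l i \<le> u i) \<Longrightarrow>
       (\<And>i j. i \<in> I \<Longrightarrow> j \<in> I \<Longrightarrow> i \<noteq> j \<Longrightarrow> u i \<le> l j \<or> u j \<le> l i) \<Longrightarrow>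
       (\<Sum>i\<in>I. u i - l i) < \<delta> \<Longrightarrow> (\<Sum>i\<in>I. F (u i) - F (l i)) < \<epsilon>"
    and \<delta>: "\<delta> > 0"
    and S: "S \<in> null_sets lborel" "S \<subseteq> {c..d}" and "c < d"
  shows "emeasure (interval_measure F) S \<le> ennreal \<epsilon>"
proof -
  let ?\<mu> = "interval_measure F"
  have mono: "\<And>x y. x \<le> y \<Longrightarrow> F x \<le> F y" using F(1) by (simp add: mono_def)
  obtain U where U: "open U" "S \<subseteq> U" "emeasure lborel (U - S) < ennreal \<delta>"
    by (rule outer_regular_lborel[OF _ \<delta>, of S]) (use S(1) in \<open>auto simp: null_sets_def\<close>)
  have US: "U = (U - S) \<union> S" using U(2) by blast
  have lU: "emeasure lborel U < ennreal \<delta>"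
  proof -
    have "emeasure lborel ((U - S) \<union> S) = emeasure lborel (U - S)"
      using S(1) U(1) by (intro emeasure_Un_null_set) auto
    then show ?thesis using U(3) US by simp
  qed
  \<comment> \<open>Each covering interval contains a point of \<open>S\<close>, hence of
    \<open>U\<close>, and the gauge then forces the interval into \<open>U\<close>.\<close>
  have g: "gauge (\<lambda>x. if x \<in> U then U else UNIV)" using U(1) by (auto simp: gauge_def)
  have cd: "S \<subseteq> cbox c d" "box c d \<noteq> {}" using S(2) \<open>c < d\<close> by auto
  obtain \<D> where D: "countable \<D>" "\<Union>\<D> \<subseteq> cbox c d"
    "\<And>K. K \<in> \<D> \<Longrightarrow> interior K \<noteq> {} \<and> (\<exists>c d. K = cbox c d)"
    "pairwise (\<lambda>A B. interior A \<inter> interior B = {}) \<D>"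
    "\<And>K. K \<in> \<D> \<Longrightarrow> \<exists>x \<in> S \<inter> K. K \<subseteq> (if x \<in> U then U else UNIV)"
    "\<And>u v. cbox u v \<in> \<D> \<Longrightarrow> \<exists>n. \<forall>i \<in> Basis. v \<bullet> i - u \<bullet> i = (d \<bullet> i - c \<bullet> i) / 2^n"
    "S \<subseteq> \<Union>\<D>"
    by (rule covering_lemma[OF cd g], rule that)
  have KU: "K \<subseteq> U" if "K \<in> \<D>" for K
    using D(5)[OF that] U(2) by (auto split: if_splits)
  have "\<forall>K\<in>\<D>. \<exists>l u. l < u \<and> K = {l..u}"
  proof
    fix K assume "K \<in> \<D>"
    then obtain l u where "K = cbox l u" "interior K \<noteq> {}" using D(3) by blast
    then show "\<exists>l u. l < u \<and> K = {l..u}" by (intro exI[of _ l] exI[of _ u]) auto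
  qed
  then obtain l u where lu: "\<And>K. K \<in> \<D> \<Longrightarrow> l K < u K" "\<And>K. K \<in> \<D> \<Longrightarrow> K = {l K..u K}"
    by metis
  have int: "interior K = {l K<..<u K}" if "K \<in> \<D>" for K
    using lu(2)[OF that] interior_atLeastAtMost_real by metis
  have finite_bound: "emeasure ?\<mu> (\<Union>\<F>) \<le> ennreal \<epsilon>" if fin: "finite \<F>" and sub: "\<F> \<subseteq> \<D>" for \<F>
  proof -
    have disj: "disjoint_family_on (\<lambda>K. {l K<..<u K}) \<F>"
      unfolding disjoint_family_on_def
    proof (intro ballI impI)
      fix K K' assume KK: "K \<in> \<F>" "K' \<in> \<F>" "K \<noteq> K'"
      then have "K \<in> \<D>" "K' \<in> \<D>" using sub by auto
      then show "{l K<..<u K} \<inter> {l K'<..<u K'} = {}"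
        using pairwiseD[OF D(4) _ _ KK(3)] int by simp
    qed
    have no: "u K \<le> l K' \<or> u K' \<le> l K" if KK: "K \<in> \<F>" "K' \<in> \<F>" "K \<noteq> K'" for K K'
    proof (rule ccontr)
      assume "\<not> ?thesis"
      moreover have "l K < u K" "l K' < u K'" using lu(1) KK sub by auto
      ultimately have "max (l K) (l K') < min (u K) (u K')" by auto
      then obtain z where "max (l K) (l K') < z" "z < min (u K) (u K')" using dense by blast
      then have "z \<in> {l K<..<u K} \<inter> {l K'<..<u K'}" by auto
      then show False using disjoint_family_onD[OF disj KK] by blast
    qed
    \<comment> \<open>Open intervals are measured because the closed ones may share end points; the
      lengths agree.\<close>
    have "ennreal (\<Sum>K\<in>\<F>. u K - l K) = (\<Sum>K\<in>\<F>. emeasure lborel {l K<..<u K})"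
      using lu(1) sub by (subst sum_ennreal[symmetric]) (auto simp: less_imp_le intro!: sum.cong)
    also have "\<dots> = emeasure lborel (\<Union>K\<in>\<F>. {l K<..<u K})"
      using disj fin by (intro sum_emeasure) auto
    also have "\<dots> \<le> emeasure lborel U"
    proof (rule emeasure_mono)
      show "(\<Union>K\<in>\<F>. {l K<..<u K}) \<subseteq> U"
      proof (rule UN_least)
        fix K assume "K \<in> \<F>"
        then have K: "K \<in> \<D>" using sub by auto
        have "{l K<..<u K} \<subseteq> {l K..u K}" by auto
        then show "{l K<..<u K} \<subseteq> U" using KU[OF K] lu(2)[OF K] by simp
      qed
    qed (use U in auto)
    also have "\<dots> < ennreal \<delta>" by (rule lU)
    finally have len: "(\<Sum>K\<in>\<F>. u K - l K) < \<delta>"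
      using lu(1) sub by (subst (asm) ennreal_less_iff) (auto intro!: sum_nonneg simp: less_imp_le)
    have "emeasure ?\<mu> (\<Union>K\<in>\<F>. K) \<le> (\<Sum>K\<in>\<F>. emeasure ?\<mu> K)"
    proof (rule emeasure_subadditive_finite[OF fin])
      show "(\<lambda>K. K) ` \<F> \<subseteq> sets ?\<mu>"
      proof clarsimp
        fix K assume "K \<in> \<F>"
        then have "K = {l K..u K}" using sub lu(2) by blast
        then show "K \<in> sets borel" by (metis atLeastAtMost_borel)
      qed
    qed
    also have "\<dots> = (\<Sum>K\<in>\<F>. ennreal (F (u K) - F (l K)))"
    proof (rule sum.cong[OF refl])
      fix K assume "K \<in> \<F>"
      then have K: "K = {l K..u K}" "l K \<le> u K" using sub lu by (blast, force)
      show "emeasure ?\<mu> K = ennreal (F (u K) - F (l K))"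
        using emeasure_interval_measure_Icc[OF K(2) mono F(2)] K(1) by simp
    qed
    also have "\<dots> = ennreal (\<Sum>K\<in>\<F>. F (u K) - F (l K))"
      using lu(1) sub mono by (intro sum_ennreal) (simp add: less_imp_le subset_iff)
    also have "\<dots> \<le> ennreal \<epsilon>"
      using fam[of \<F> l u] fin lu(1) sub no len by (intro ennreal_leI less_imp_le) (auto simp: less_imp_le subset_iff)
    finally show ?thesis by simp
  qed
  show ?thesis
  proof (cases "\<D> = {}")
    case True
    then show ?thesis using D(7) by simp
  next
    case False
    \<comment> \<open>The enumeration repeats members if the covering is finite, which is harmless
      for unions.\<close>
    define A where "A n = \<Union>(from_nat_into \<D> ` {..<n})" for n :: nat
    have sub: "from_nat_into \<D> ` {..<n} \<subseteq> \<D>" for n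
      using from_nat_into[OF False] by auto
    have meas: "range A \<subseteq> sets ?\<mu>"
    proof clarsimp
      fix n
      have "A n = (\<Union>i<n. {l (from_nat_into \<D> i)..u (from_nat_into \<D> i)})"
        unfolding A_def using lu(2)[OF from_nat_into[OF False]] by auto
      then show "A n \<in> sets borel" by auto
    qed
    have "incseq A" by (force simp: incseq_def A_def)
    have "S \<subseteq> (\<Union>n. A n)"
    proof
      fix x assume "x \<in> S"
      then obtain K where "K \<in> \<D>" "x \<in> K" using D(7) by auto
      then obtain i where "from_nat_into \<D> i = K"
        using from_nat_into_surj[OF D(1)] by metis
      then have "x \<in> A (Suc i)" using \<open>x \<in> K\<close> by (auto simp: A_def)
      then show "x \<in> (\<Union>n. A n)" by blast
    qed
    then have "emeasure ?\<mu> S \<le> emeasure ?\<mu> (\<Union>n. A n)"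
      using meas by (intro emeasure_mono) auto
    also have "\<dots> = (SUP n. emeasure ?\<mu> (A n))"
      using SUP_emeasure_incseq[OF meas \<open>incseq A\<close>] by simp
    also have "\<dots> \<le> ennreal \<epsilon>"
      unfolding A_def by (intro SUP_least finite_bound sub) simp
    finally show ?thesis .
  qed
qed

lemma mono_abs_cont_on_has_density:
  assumes "a \<le> b" and h: "abs_cont_on a b h" "mono_on {a..b} h"
  obtains g where "\<And>t. t \<in> {a..b} \<Longrightarrow> (g has_integral (h t - h a)) {a..t}"
proof -
  \<comment> \<open>Clamping extends \<open>h\<close> by constants to a monotone continuous function
    on the line. As \<open>k\<close> is monotone and never lengthens an interval, any family of
    intervals is carried to an admissible one inside \<open>[a, b]\<close>.\<close>
  define k where "k t = max a (min b t)" for t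
  define F where "F t = h (k t)" for t
  have k: "k t \<in> {a..b}" for t using \<open>a \<le> b\<close> by (auto simp: k_def)
  have k_mono: "k s \<le> k t" if "s \<le> t" for s t using that by (auto simp: k_def)
  have k_id: "k t = t" if "t \<in> {a..b}" for t using that by (auto simp: k_def)
  have mono: "F s \<le> F t" if "s \<le> t" for s t
    using mono_onD[OF h(2) k k k_mono[OF that]] by (simp add: F_def)
  have "continuous_on UNIV k" unfolding k_def by (intro continuous_intros)
  moreover have "continuous_on (range k) h"
    using abs_cont_on_imp_continuous_on[OF h(1)] k by (meson continuous_on_subset image_subsetI)
  ultimately have cont: "continuous_on UNIV F"
    using continuous_on_compose[of UNIV k h] by (simp add: F_def o_def)
  then have rcont: "continuous (at_right x) F" for x
    by (simp add: continuous_on_eq_continuous_at continuous_at_imp_continuous_within)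
  let ?\<mu> = "interval_measure F"
  have bounded_null: "emeasure ?\<mu> S = 0" if S: "S \<in> null_sets lborel" "S \<subseteq> {c..d}" "c < d" for S c d
  proof -
    have "emeasure ?\<mu> S \<le> ennreal \<epsilon>" if e: "\<epsilon> > 0" for \<epsilon>
    proof -
      obtain \<delta> where d: "\<delta> > 0" and D: "\<forall>(I::real set set) l u. nonoverlapping a b I l u \<longrightarrow>
         (\<Sum>i\<in>I. u i - l i) < \<delta> \<longrightarrow> (\<Sum>i\<in>I. \<bar>h (u i) - h (l i)\<bar>) < \<epsilon>"
        using abs_cont_on_finite_family[OF h(1) e, where 'i="real set"] by (elim exE conjE)
      show ?thesis
      proof (rule emeasure_interval_measure_small[OF _ cont _ _ d S])
        show "mono F" using mono by (simp add: mono_def)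
        show "0 \<le> \<epsilon>" using e by simp
        fix I :: "real set set" and l u
        assume I: "finite I" "\<And>i. i \<in> I \<Longrightarrow> l i \<le> u i"
          "\<And>i j. i \<in> I \<Longrightarrow> j \<in> I \<Longrightarrow> i \<noteq> j \<Longrightarrow> u i \<le> l j \<or> u j \<le> l i"
          "(\<Sum>i\<in>I. u i - l i) < \<delta>"
        have no: "nonoverlapping a b I (\<lambda>i. k (l i)) (\<lambda>i. k (u i))"
          unfolding nonoverlapping_def
        proof (intro conjI ballI impI)
          show "a \<le> k (l i)" "k (u i) \<le> b" "k (l i) \<le> k (u i)" if "i \<in> I" for i
            using k I(2)[OF that] k_mono by auto
          show "k (u i) \<le> k (l j) \<or> k (u j) \<le> k (l i)" if "i \<in> I" "j \<in> I" "i \<noteq> j" for i j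
            using I(3)[OF that] k_mono by blast
        qed (rule I(1))
        have "(\<Sum>i\<in>I. k (u i) - k (l i)) \<le> (\<Sum>i\<in>I. u i - l i)"
        proof (rule sum_mono)
          fix i assume "i \<in> I"
          then show "k (u i) - k (l i) \<le> u i - l i" using I(2) by (force simp: k_def)
        qed
        then have "(\<Sum>i\<in>I. k (u i) - k (l i)) < \<delta>" using I(4) by linarith
        then have "(\<Sum>i\<in>I. \<bar>h (k (u i)) - h (k (l i))\<bar>) < \<epsilon>"
          by (rule D[rule_format, OF no])
        moreover have "(\<Sum>i\<in>I. F (u i) - F (l i)) \<le> (\<Sum>i\<in>I. \<bar>h (k (u i)) - h (k (l i))\<bar>)"
          unfolding F_def by (intro sum_mono) auto
        ultimately show "(\<Sum>i\<in>I. F (u i) - F (l i)) < \<epsilon>" by linarith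
      qed
    qed
    then have "emeasure ?\<mu> S \<le> 0 + ennreal \<epsilon>" if "\<epsilon> > 0" for \<epsilon> using that by simp
    then have "emeasure ?\<mu> S \<le> 0" by (rule ennreal_le_epsilon)
    then show ?thesis by simp
  qed
  have "absolutely_continuous lborel ?\<mu>"
    unfolding absolutely_continuous_def
  proof
    fix S :: "real set" assume S: "S \<in> null_sets lborel"
    \<comment> \<open>The bound above is for bounded sets, so \<open>S\<close> is exhausted by
      windows; \<open>Suc n\<close> keeps each window nondegenerate.\<close>
    have "(\<Union>n::nat. S \<inter> {- real (Suc n)..real (Suc n)}) \<in> null_sets ?\<mu>"
    proof (rule null_sets_UN)
      fix n :: nat
      have "S \<inter> {- real (Suc n)..real (Suc n)} \<in> null_sets lborel"
        using S by (intro null_set_Int2) auto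
      then show "S \<inter> {- real (Suc n)..real (Suc n)} \<in> null_sets ?\<mu>"
        using bounded_null[of "S \<inter> {- real (Suc n)..real (Suc n)}" "- real (Suc n)" "real (Suc n)"]
        by (auto simp: null_sets_def)
    qed
    moreover have "(\<Union>n::nat. S \<inter> {- real (Suc n)..real (Suc n)}) = S"
    proof (intro equalityI subsetI)
      fix x assume "x \<in> S"
      moreover obtain n :: nat where "\<bar>x\<bar> \<le> real n" using real_arch_simple by blast
      ultimately have "x \<in> S \<inter> {- real (Suc n)..real (Suc n)}" by auto
      then show "x \<in> (\<Union>n::nat. S \<inter> {- real (Suc n)..real (Suc n)})" by blast
    qed auto
    ultimately show "S \<in> null_sets ?\<mu>" by simp
  qed
  then obtain f where f: "f \<in> borel_measurable lborel" "density lborel f = ?\<mu>"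
    using sigma_finite_measure.Radon_Nikodym[OF sigma_finite_lborel, of ?\<mu>] by auto
  have fb[measurable]: "f \<in> borel_measurable borel" using f(1) by simp
  have int: "(\<integral>\<^sup>+x. f x * indicator {a..t} x \<partial>lborel) = ennreal (h t - h a)" if t: "t \<in> {a..b}" for t
  proof -
    have "(\<integral>\<^sup>+x. f x * indicator {a..t} x \<partial>lborel) = emeasure ?\<mu> {a..t}"
      unfolding f(2)[symmetric] by (rule emeasure_density[symmetric]) auto
    also have "\<dots> = ennreal (F t - F a)"
      using t by (intro emeasure_interval_measure_Icc mono cont) auto
    finally show ?thesis using t \<open>a \<le> b\<close> by (simp add: F_def k_id)
  qed
  show thesis
  proof (rule that[of "\<lambda>x. enn2real (f x)"])
    fix t assume t: "t \<in> {a..b}"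
    \<comment> \<open>The density is extended-valued. A finite integral makes it finite almost
      everywhere on \<open>{a..t}\<close>, so \<open>enn2real\<close> alters no integral.\<close>
    have "AE x in lborel. f x * indicator {a..t} x \<noteq> \<infinity>"
      using int[OF t] by (intro nn_integral_noteq_infinite) auto
    then have "(\<integral>\<^sup>+x. ennreal (enn2real (f x) * indicator {a..t} x) \<partial>lborel) = ennreal (h t - h a)"
      unfolding int[OF t, symmetric]
    proof (intro nn_integral_cong_AE, eventually_elim)
      fix x assume "f x * indicator {a..t} x \<noteq> \<infinity>"
      then show "ennreal (enn2real (f x) * indicator {a..t} x) = f x * indicator {a..t} x"
        by (cases "x \<in> {a..t}") (auto simp: less_top)
    qed
    then have "((\<lambda>x. enn2real (f x) * indicator {a..t} x) has_integral (h t - h a)) UNIV"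
      using mono_onD[OF h(2), of a t] t
      by (intro nn_integral_has_integral) auto
    then show "((\<lambda>x. enn2real (f x)) has_integral (h t - h a)) {a..t}"
      by (subst has_integral_restrict_UNIV[symmetric])
        (simp add: indicator_def of_bool_def if_distrib[of "\<lambda>x. _ * x"] cong: if_cong)
  qed
qed

section \<open>Almost everywhere differentiation of indefinite integrals\<close>

lemma AE_lborel_not_in_negligible: "negligible N \<Longrightarrow> AE x in lborel. x \<notin> N"
  using AE_not_in[of N lebesgue] by (simp add: negligible_iff_null_sets AE_completion_iff)

text \<open>The differentiation theorem used here concerns averages over \<open>[x, x + h]\<close>
  with \<open>h > 0\<close>, that is, right derivatives. Left derivatives come from the reflected
  function, whose exceptional set is reflected back.\<close>

lemma indefinite_integral_AE_derivative:
  fixes g :: "real \<Rightarrow> real"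
  assumes g: "g integrable_on {a..b}"
  shows "AE t in lborel. t \<in> {a<..<b} \<longrightarrow>
    ((\<lambda>t. integral {a..t} g) has_real_derivative g t) (at t)"
proof -
  \<comment> \<open>That theorem asks for integrability on every box, hence the extension by
    zero.\<close>
  define G where "G t = (if t \<in> {a..b} then g t else 0)" for t
  have G: "G integrable_on cbox c d" for c d :: real
  proof -
    have "G integrable_on UNIV"
      using g unfolding G_def by (simp only: integrable_restrict_UNIV)
    then show ?thesis by (rule integrable_on_subcbox) simp
  qed
  have G': "(\<lambda>t. G (- t)) integrable_on cbox c d" for c d :: real
    using G[of "- d" "- c"] Henstock_Kurzweil_Integration.integrable_reflect_real[of G "- c" "- d"]
    by (simp del: Henstock_Kurzweil_Integration.integrable_reflect_real)
  obtain N1 where N1: "negligible N1" "\<And>x e. x \<notin> N1 \<Longrightarrow> 0 < e \<Longrightarrow>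
      \<exists>d>0. \<forall>h. 0 < h \<and> h < d \<longrightarrow>
        norm (integral (cbox x (x + h *\<^sub>R One)) G /\<^sub>R h ^ DIM(real) - G x) < e"
    by (rule integrable_ccontinuous_explicit[of G, OF G], rule that)
  obtain N2 where N2: "negligible N2" "\<And>x e. x \<notin> N2 \<Longrightarrow> 0 < e \<Longrightarrow>
      \<exists>d>0. \<forall>h. 0 < h \<and> h < d \<longrightarrow>
        norm (integral (cbox x (x + h *\<^sub>R One)) (\<lambda>t. G (- t)) /\<^sub>R h ^ DIM(real) - G (- x)) < e"
    by (rule integrable_ccontinuous_explicit[of "\<lambda>t. G (- t)", OF G'], rule that)
  have "negligible (uminus ` N2)"
    by (rule negligible_differentiable_image_negligible[OF _ N2(1)]) (auto intro!: derivative_intros)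
  then have "AE t in lborel. t \<notin> uminus ` N2" by (rule AE_lborel_not_in_negligible)
  moreover have "AE t in lborel. t \<notin> N1" using N1(1) by (rule AE_lborel_not_in_negligible)
  ultimately show ?thesis
  proof eventually_elim
    fix t assume t: "t \<notin> uminus ` N2" "t \<notin> N1"
    show "t \<in> {a<..<b} \<longrightarrow> ((\<lambda>t. integral {a..t} g) has_real_derivative g t) (at t)"
    proof
      assume ab: "t \<in> {a<..<b}"
      then have Gt: "G t = g t" by (simp add: G_def)
      have t': "- t \<notin> N2" using t(1) by force
      have Gg: "integral {c..d} G = integral {c..d} g" if "a \<le> c" "d \<le> b" for c d
        by (rule integral_cong) (use that in \<open>auto simp: G_def\<close>)
      have diff: "integral {a..d} g - integral {a..c} g = integral {c..d} G"
        if "a \<le> c" "c \<le> d" "d \<le> b" for c d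
      proof -
        have "g integrable_on {a..d}" using g by (rule integrable_on_subinterval) (use that in auto)
        then have "integral {a..c} g + integral {c..d} g = integral {a..d} g"
          using that by (intro Henstock_Kurzweil_Integration.integral_combine) auto
        then show ?thesis using Gg that by simp
      qed
      show "((\<lambda>t. integral {a..t} g) has_real_derivative g t) (at t)"
        unfolding DERIV_def
      proof (rule LIM_I)
        fix e :: real assume e: "0 < e"
        obtain d1 where d1: "d1 > 0" "\<And>h. 0 < h \<Longrightarrow> h < d1 \<Longrightarrow> \<bar>integral {t..t+h} G / h - G t\<bar> < e"
          using N1(2)[OF t(2) e] by (auto simp: divide_inverse mult.commute)
        obtain d2 where d2: "d2 > 0" "\<And>h. 0 < h \<Longrightarrow> h < d2 \<Longrightarrow>
            \<bar>integral {-t..-t+h} (\<lambda>t. G (- t)) / h - G t\<bar> < e"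
          using N2(2)[OF t' e] by (auto simp: divide_inverse mult.commute)
        \<comment> \<open>Besides meeting both one-sided estimates, \<open>s\<close> keeps
          \<open>t + h\<close> inside \<open>[a, b]\<close>, where \<open>G\<close> and
          \<open>g\<close> agree.\<close>
        define s where "s = min (min d1 d2) (min (t - a) (b - t))"
        have s: "s > 0" using d1 d2 ab by (auto simp: s_def)
        show "\<exists>s>0. \<forall>h. h \<noteq> 0 \<and> norm (h - 0) < s \<longrightarrow>
          norm ((integral {a..t + h} g - integral {a..t} g) / h - g t) < e"
        proof (intro exI[of _ s] conjI allI impI s)
          fix h :: real assume h: "h \<noteq> 0 \<and> norm (h - 0) < s"
          show "norm ((integral {a..t + h} g - integral {a..t} g) / h - g t) < e"
          proof (cases "h > 0")
            case True
            have "integral {a..t + h} g - integral {a..t} g = integral {t..t+h} G"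
              by (rule diff) (use h True ab in \<open>auto simp: s_def\<close>)
            then show ?thesis using d1(2)[of h] h True Gt by (auto simp: s_def)
          next
            case False
            then have neg: "h < 0" using h by auto
            have "integral {a..t} g - integral {a..t + h} g = integral {t+h..t} G"
              by (rule diff) (use h neg ab in \<open>auto simp: s_def\<close>)
            also have "\<dots> = integral {-t..-t+(-h)} (\<lambda>t. G (- t))"
              using Henstock_Kurzweil_Integration.integral_reflect_real[of t "t + h" G]
              by (simp del: Henstock_Kurzweil_Integration.integral_reflect_real)
            finally have "(integral {a..t + h} g - integral {a..t} g) / h =
                integral {-t..-t+(-h)} (\<lambda>t. G (- t)) / (- h)"
              using neg by (simp add: field_simps)
            then show ?thesis using d2(2)[of "- h"] h neg Gt by (auto simp: s_def)
          qed
        qed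
      qed
    qed
  qed
qed

text \<open>On \<open>[a, b]\<close> the function differs from an indefinite integral by a constant.
  This applies both to the prescribed \<open>a'\<close> and to the density supplied by
  Radon-Nikodym.\<close>

lemma weak_deriv_on_AE_derivative:
  assumes "weak_deriv_on a b f g"
  shows "AE t in lborel. t \<in> {a<..<b} \<longrightarrow> (f has_real_derivative g t) (at t)"
proof -
  have g: "g integrable_on {a..b}" and f: "\<And>t. t \<in> {a..b} \<Longrightarrow> f t = f a + integral {a..t} g"
    using assms unfolding weak_deriv_on_def by blast+
  show ?thesis
    using indefinite_integral_AE_derivative[OF g]
  proof eventually_elim
    fix t assume D: "t \<in> {a<..<b} \<longrightarrow> ((\<lambda>t. integral {a..t} g) has_real_derivative g t) (at t)"
    show "t \<in> {a<..<b} \<longrightarrow> (f has_real_derivative g t) (at t)"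
    proof
      assume t: "t \<in> {a<..<b}"
      then have "((\<lambda>t. f a + integral {a..t} g) has_real_derivative g t) (at t)"
        using D DERIV_add[OF DERIV_const[of "f a"], of "\<lambda>t. integral {a..t} g" "g t" t] by simp
      then show "(f has_real_derivative g t) (at t)"
        by (rule has_field_derivative_transform_within_open[of _ _ _ "{a<..<b}"])
          (use t in \<open>auto intro!: f[symmetric]\<close>)
    qed
  qed
qed

theorem abs_cont_on_imp_weak_deriv_on:
  assumes "a \<le> b" and f: "abs_cont_on a b f"
  obtains g where "weak_deriv_on a b f g"
proof -
  obtain u v where u: "abs_cont_on a b u" and v: "abs_cont_on a b v"
    and mono: "mono_on {a..b} u" "mono_on {a..b} v" and uv: "\<And>t. f t = u t - v t"
    by (rule abs_cont_on_mono_decomposition[OF f], rule that)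
  obtain g1 where g1: "\<And>t. t \<in> {a..b} \<Longrightarrow> (g1 has_integral (u t - u a)) {a..t}"
    by (rule mono_abs_cont_on_has_density[OF \<open>a \<le> b\<close> u mono(1)], rule that)
  obtain g2 where g2: "\<And>t. t \<in> {a..b} \<Longrightarrow> (g2 has_integral (v t - v a)) {a..t}"
    by (rule mono_abs_cont_on_has_density[OF \<open>a \<le> b\<close> v mono(2)], rule that)
  have G: "((\<lambda>t. g1 t - g2 t) has_integral (f t - f a)) {a..t}" if "t \<in> {a..b}" for t
    using has_integral_diff[OF g1[OF that] g2[OF that]] by (simp add: uv algebra_simps)
  show thesis
  proof (rule that[of "\<lambda>t. g1 t - g2 t"], unfold weak_deriv_on_def, intro conjI ballI)
    show "(\<lambda>t. g1 t - g2 t) integrable_on {a..b}"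
      using G[of b] \<open>a \<le> b\<close> by auto
    show "f t = f a + integral {a..t} (\<lambda>t. g1 t - g2 t)" if "t \<in> {a..b}" for t
      using integral_unique[OF G[OF that]] by simp
  qed
qed

corollary abs_cont_on_AE_differentiable:
  assumes "a \<le> b" "abs_cont_on a b f"
  shows "AE t in lborel. t \<in> {a<..<b} \<longrightarrow> (\<exists>D. (f has_real_derivative D) (at t))"
proof -
  obtain g where "weak_deriv_on a b f g" using abs_cont_on_imp_weak_deriv_on[OF assms] .
  from weak_deriv_on_AE_derivative[OF this] show ?thesis by eventually_elim blast
qed

text \<open>Versions of the derivative that agree almost everywhere have the same integral. Leaving
  \<open>f'\<close> free allows it to be a section of a jointly measurable function.\<close>

corollary abs_cont_on_has_integral_derivative:
  assumes "a \<le> b" "abs_cont_on a b f"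
    and d: "AE t in lborel. t \<in> {a<..<b} \<longrightarrow> (f has_real_derivative f' t) (at t)"
  shows "(f' has_integral (f b - f a)) {a..b}"
proof -
  obtain g where g: "weak_deriv_on a b f g" using abs_cont_on_imp_weak_deriv_on[OF assms(1,2)] .
  then have "(g has_integral (f b - f a)) {a..b}"
    unfolding weak_deriv_on_def has_integral_iff using \<open>a \<le> b\<close>
    by (metis add_diff_cancel_left' atLeastAtMost_iff order_refl)
  moreover have "AE t in lborel. t \<in> {a..b} \<longrightarrow> g t = f' t"
    using d weak_deriv_on_AE_derivative[OF g] AE_lborel_singleton[of a] AE_lborel_singleton[of b]
  proof eventually_elim
    fix t assume "t \<in> {a<..<b} \<longrightarrow> (f has_real_derivative f' t) (at t)"
      "t \<in> {a<..<b} \<longrightarrow> (f has_real_derivative g t) (at t)" "t \<noteq> a" "t \<noteq> b"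
    then show "t \<in> {a..b} \<longrightarrow> g t = f' t" using DERIV_unique by fastforce
  qed
  ultimately show ?thesis by (simp add: has_integral_AE[of "{a..b}" g f'])
qed

section \<open>Hoelder's inequality\<close>

text \<open>Young's inequality for normalized factors is integrated against \<open>w\<close>. The
  density stays a weight so that all \<open>t\<close> share one base measure, and the moments enter
  through real upper bounds because that of the estimator is known only to be below the
  supremum.\<close>

lemma weighted_Holder_nn_integral:
  fixes u v w :: "'x \<Rightarrow> real"
  assumes pq: "p > 1" "q > 1" "1 / p + 1 / q = 1"
    and [measurable]: "u \<in> borel_measurable M" "v \<in> borel_measurable M" "w \<in> borel_measurable M"
    and w: "\<And>x. x \<in> space M \<Longrightarrow> 0 \<le> w x"
    and A: "(\<integral>\<^sup>+x. ennreal (\<bar>u x\<bar> powr p * w x) \<partial>M) \<le> ennreal A" "A \<ge> 0"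
    and B: "(\<integral>\<^sup>+x. ennreal (\<bar>v x\<bar> powr q * w x) \<partial>M) \<le> ennreal B" "B \<ge> 0"
  shows "(\<integral>\<^sup>+x. ennreal (\<bar>u x\<bar> * \<bar>v x\<bar> * w x) \<partial>M) \<le> ennreal (A powr (1 / p) * B powr (1 / q))"
proof -
  \<comment> \<open>Normalization fails if a bound is 0. Then the factor \<open>z\<close> in
    question vanishes almost everywhere outside the zeros of \<open>w\<close>;
    \<open>z \<in> {u, v}\<close> treats both cases at once.\<close>
  have zero: "(\<integral>\<^sup>+x. ennreal (\<bar>u x\<bar> * \<bar>v x\<bar> * w x) \<partial>M) = 0"
    if r: "r > 1" and z: "z \<in> {u, v}" and int: "(\<integral>\<^sup>+x. ennreal (\<bar>z x\<bar> powr r * w x) \<partial>M) \<le> 0" for r z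
  proof -
    have [measurable]: "z \<in> borel_measurable M" using z by auto
    have "AE x in M. ennreal (\<bar>z x\<bar> powr r * w x) = 0"
      using int by (subst nn_integral_0_iff_AE[symmetric]) auto
    then have "AE x in M. ennreal (\<bar>u x\<bar> * \<bar>v x\<bar> * w x) = 0"
      using AE_space
    proof eventually_elim
      fix x assume x: "ennreal (\<bar>z x\<bar> powr r * w x) = 0" "x \<in> space M"
      then have "\<bar>z x\<bar> powr r * w x \<le> 0" by (simp add: ennreal_eq_0_iff)
      moreover have "0 \<le> \<bar>z x\<bar> powr r * w x" using w[OF x(2)] by simp
      ultimately have "\<bar>z x\<bar> powr r * w x = 0" by (rule order_antisym)
      then have "z x = 0 \<or> w x = 0" by auto
      then show "ennreal (\<bar>u x\<bar> * \<bar>v x\<bar> * w x) = 0" using z by auto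
    qed
    then show ?thesis by (subst nn_integral_0_iff_AE) auto
  qed
  show ?thesis
  proof (cases "A = 0 \<or> B = 0")
    case True
    then show ?thesis using zero[of p u] zero[of q v] pq A B by auto
  next
    case False
    then have AB: "A > 0" "B > 0" using A B by auto
    define a where "a = A powr (1 / p)"
    define b where "b = B powr (1 / q)"
    have ab: "a > 0" "b > 0" "a powr p = A" "b powr q = B"
      using AB pq by (auto simp: a_def b_def powr_powr)
    \<comment> \<open>Young's inequality for |u|/a and |v|/b is multiplied by
      \<open>a * b * w\<close>; after integration the right side becomes
      \<open>a * b * (1 / p + 1 / q)\<close>.\<close>
    have young: "\<bar>u x\<bar> * \<bar>v x\<bar> * w x \<le> (a * b / (A * p)) * (\<bar>u x\<bar> powr p * w x) + (a * b / (B * q)) * (\<bar>v x\<bar> powr q * w x)"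
      if x: "x \<in> space M" for x
    proof -
      have "(\<bar>u x\<bar> / a) * (\<bar>v x\<bar> / b) \<le> (\<bar>u x\<bar> / a) powr p / p + (\<bar>v x\<bar> / b) powr q / q"
        using ab by (intro Youngs_inequality pq) auto
      also have "\<dots> = \<bar>u x\<bar> powr p / (A * p) + \<bar>v x\<bar> powr q / (B * q)"
        using ab by (simp add: powr_divide)
      finally have "(\<bar>u x\<bar> / a) * (\<bar>v x\<bar> / b) * (a * b * w x) \<le>
          (\<bar>u x\<bar> powr p / (A * p) + \<bar>v x\<bar> powr q / (B * q)) * (a * b * w x)"
        using ab w[OF x] by (intro mult_right_mono) auto
      moreover have "(\<bar>u x\<bar> / a) * (\<bar>v x\<bar> / b) * (a * b * w x) = \<bar>u x\<bar> * \<bar>v x\<bar> * w x"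
        using ab by simp
      ultimately show ?thesis by (simp add: algebra_simps)
    qed
    have "(\<integral>\<^sup>+x. ennreal (\<bar>u x\<bar> * \<bar>v x\<bar> * w x) \<partial>M) \<le>
      (\<integral>\<^sup>+x. ennreal (a * b / (A * p)) * ennreal (\<bar>u x\<bar> powr p * w x) +
         ennreal (a * b / (B * q)) * ennreal (\<bar>v x\<bar> powr q * w x) \<partial>M)"
    proof (rule nn_integral_mono)
      fix x assume x: "x \<in> space M"
      have c: "0 \<le> a * b / (A * p)" "0 \<le> a * b / (B * q)" using ab AB pq by auto
      have "ennreal (\<bar>u x\<bar> * \<bar>v x\<bar> * w x) \<le> ennreal ((a * b / (A * p)) * (\<bar>u x\<bar> powr p * w x) + (a * b / (B * q)) * (\<bar>v x\<bar> powr q * w x))"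
        by (rule ennreal_leI[OF young[OF x]])
      also have "\<dots> = ennreal (a * b / (A * p)) * ennreal (\<bar>u x\<bar> powr p * w x) +
         ennreal (a * b / (B * q)) * ennreal (\<bar>v x\<bar> powr q * w x)"
        using c w[OF x] by (subst ennreal_plus) (auto simp: ennreal_mult simp del: times_divide_eq_left)
      finally show "ennreal (\<bar>u x\<bar> * \<bar>v x\<bar> * w x) \<le> \<dots>" .
    qed
    also have "\<dots> = ennreal (a * b / (A * p)) * (\<integral>\<^sup>+x. ennreal (\<bar>u x\<bar> powr p * w x) \<partial>M) +
         ennreal (a * b / (B * q)) * (\<integral>\<^sup>+x. ennreal (\<bar>v x\<bar> powr q * w x) \<partial>M)"
      by (subst nn_integral_add) (auto simp: nn_integral_cmult)
    also have "\<dots> \<le> ennreal (a * b / (A * p)) * ennreal A + ennreal (a * b / (B * q)) * ennreal B"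
      using A B by (intro add_mono mult_left_mono) auto
    also have "\<dots> = ennreal (a * b / (A * p) * A + a * b / (B * q) * B)"
      using ab AB pq by (subst ennreal_plus) (auto simp: ennreal_mult simp del: times_divide_eq_left)
    also have "a * b / (A * p) * A + a * b / (B * q) * B = a * b * (1 / p + 1 / q)"
      using AB by (simp add: distrib_left)
    finally show ?thesis using pq by (simp add: a_def b_def)
  qed
qed

section \<open>Measurability of the score\<close>

lemma dt_dens_eq_derivative:
  assumes "t \<in> {t1<..<t2}" "(p x has_real_derivative D) (at t)"
  shows "dt_dens p t1 t2 x t = D"
proof -
  have at: "at t within {t1..t2} = at t"
    using assms(1) by (intro at_within_Icc_at) auto
  have "p x differentiable (at t)"
    using assms(2) real_differentiable_def by blast
  moreover have "vector_derivative (p x) (at t) = D"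
    using assms(2) by (intro vector_derivative_at) (simp add: has_real_derivative_iff_has_vector_derivative)
  ultimately show ?thesis by (simp add: dt_dens_def at)
qed

text \<open>Where the density vanishes it attains its minimum, so its derivative vanishes too and the
  junk value \<open>0\<close> of the score does no harm.\<close>
lemma score_mult_density:
  assumes t: "t \<in> {t1<..<t2}" and D: "(p x has_real_derivative D) (at t)"
    and nonneg: "\<And>s. s \<in> {t1..t2} \<Longrightarrow> 0 \<le> p x s"
  shows "score p t1 t2 x t * p x t = D"
proof (cases "p x t = 0")
  case True
  have "D = 0"
  proof (rule DERIV_local_min[OF D])
    show "0 < min (t - t1) (t2 - t)" using t by auto
    show "\<forall>y. \<bar>t - y\<bar> < min (t - t1) (t2 - t) \<longrightarrow> p x t \<le> p x y"
      using nonneg True by (auto simp: abs_if split: if_splits)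
  qed
  then show ?thesis using True by simp
next
  case False
  then show ?thesis by (simp add: score_def dt_dens_eq_derivative[of t t1 t2 p x D, OF t D])
qed

text \<open>The set where the Fisher integrand does not vanish is measurable, and on it the derivative
  exists, hence is a pointwise limit of difference quotients.\<close>
lemma borel_measurable_score:
  assumes T: "t1 < t2" and t: "t \<in> {t1..t2}"
    and p_meas [measurable]: "\<And>s. (\<lambda>x. p x s) \<in> borel_measurable nu"
    and I_meas [measurable]: "(\<lambda>x. (dt_dens p t1 t2 x t)\<^sup>2 / p x t) \<in> borel_measurable nu"
  shows "(\<lambda>x. score p t1 t2 x t) \<in> borel_measurable nu"
proof -
  \<comment> \<open>Sample points must stay in the interval: they tend to \<open>t\<close> from the
    side of \<open>t2\<close>, or of \<open>t1\<close> if \<open>t = t2\<close>. Each is a convex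
    combination of \<open>t\<close> and the end point \<open>t + e\<close>.\<close>
  define e where "e = (if t < t2 then t2 - t else t1 - t)"
  define s where "s n = t + e / real (Suc n)" for n
  have e: "e \<noteq> 0" using T t by (auto simp: e_def)
  have s_in: "s n \<in> {t1..t2}" for n
  proof -
    define c where "c = 1 / real (Suc n)"
    have c: "0 \<le> c" "c \<le> 1" by (auto simp: c_def)
    have "s n = (1 - c) * t + c * (t + e)" by (simp add: s_def c_def algebra_simps add_divide_distrib)
    moreover have "t + e \<in> {t1..t2}" using t T by (auto simp: e_def)
    ultimately show ?thesis
      using c t convexD_alt[of "{t1..t2}" t "t + e" c] by simp
  qed
  have s_ne: "s n \<noteq> t" for n using e by (simp add: s_def)
  have "(\<lambda>n. t + e * (1 / real (Suc n))) \<longlonglongrightarrow> t + e * 0"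
    by (intro tendsto_intros lim_1_over_n[THEN LIMSEQ_Suc])
  then have "s \<longlonglongrightarrow> t" by (simp add: s_def[abs_def])
  then have s_lim: "filterlim s (at t within {t1..t2}) sequentially"
    using s_in s_ne by (auto simp: filterlim_at)
  define L where "L x = lim (\<lambda>n. (p x (s n) - p x t) / (s n - t))" for x
  have [measurable]: "L \<in> borel_measurable nu"
    unfolding L_def by measurable
  have L: "dt_dens p t1 t2 x t = L x" if "dt_dens p t1 t2 x t \<noteq> 0" for x
  proof -
    have "p x differentiable (at t within {t1..t2})"
      using that by (auto simp: dt_dens_def split: if_splits)
    then have "(p x has_vector_derivative dt_dens p t1 t2 x t) (at t within {t1..t2})"
      by (simp add: dt_dens_def vector_derivative_works[symmetric])
    then have "((\<lambda>y. (p x y - p x t) / (y - t)) \<longlongrightarrow> dt_dens p t1 t2 x t) (at t within {t1..t2})"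
      by (simp add: has_real_derivative_iff_has_vector_derivative[symmetric] has_field_derivative_iff)
    from filterlim_compose[OF this s_lim] show ?thesis
      unfolding L_def by (rule limI[symmetric])
  qed
  \<comment> \<open>As division by 0 gives 0, the Fisher integrand and the score have the same
    zeros, including those from a vanishing density.\<close>
  have "score p t1 t2 x t = (if (dt_dens p t1 t2 x t)\<^sup>2 / p x t = 0 then 0 else L x / p x t)" for x
    using L[of x] by (auto simp: score_def)
  then show ?thesis by (simp only:) measurable
qed

section \<open>Joint measurability of the time derivative\<close>

lemma le_on_rationals_imp_le:
  fixes \<phi> :: "real \<Rightarrow> real"
  assumes W: "open W" "h \<in> W" and cont: "isCont \<phi> h" and le: "\<And>r. of_rat r \<in> W \<Longrightarrow> \<phi> (of_rat r) \<le> c"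
  shows "\<phi> h \<le> c"
proof (rule ccontr)
  assume "\<not> \<phi> h \<le> c"
  then have "eventually (\<lambda>y. c < \<phi> y) (nhds h)"
    using cont by (intro order_tendstoD(1)[of \<phi> "\<phi> h"]) (auto simp: isCont_def tendsto_at_iff_tendsto_nhds)
  moreover have "eventually (\<lambda>y. y \<in> W) (nhds h)"
    using W by (simp add: eventually_nhds_in_open)
  ultimately have "eventually (\<lambda>y. c < \<phi> y \<and> y \<in> W) (nhds h)" by eventually_elim simp
  then obtain d where d: "d > 0" "\<And>y. dist y h < d \<Longrightarrow> c < \<phi> y \<and> y \<in> W"
    by (auto simp: eventually_nhds_metric)
  obtain r where "h < of_rat r" "of_rat r < h + d" using of_rat_dense[of h "h + d"] d(1) by auto
  then have "dist (of_rat r) h < d" by (simp add: dist_real_def)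
  then show False using d(2) le by fastforce
qed

text \<open>Restricting the increments to rationals makes differentiability a countable combination of
  measurable conditions; for continuous functions nothing is lost.\<close>
definition rat_deriv :: "(real \<Rightarrow> real) \<Rightarrow> real \<Rightarrow> real \<Rightarrow> bool" where
  "rat_deriv f t D \<longleftrightarrow> (\<forall>k::nat. \<exists>m::nat. \<forall>r::rat. r \<noteq> 0 \<and> \<bar>real_of_rat r\<bar> < 1 / real (Suc m) \<longrightarrow>
      \<bar>(f (t + of_rat r) - f t) / of_rat r - D\<bar> \<le> 1 / real (Suc k))"

lemma has_derivative_imp_rat_deriv:
  assumes "(f has_real_derivative D) (at t)"
  shows "rat_deriv f t D"
  unfolding rat_deriv_def
proof
  fix k :: nat
  have "(\<lambda>h. (f (t + h) - f t) / h) \<midarrow>0\<rightarrow> D" using assms by (simp add: DERIV_def)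
  then have "\<exists>s>0. \<forall>h. h \<noteq> 0 \<and> norm (h - 0) < s \<longrightarrow> norm ((f (t + h) - f t) / h - D) < 1 / real (Suc k)"
    by (rule LIM_D) simp
  then obtain s where s: "s > 0" "\<And>h. h \<noteq> 0 \<Longrightarrow> \<bar>h\<bar> < s \<Longrightarrow> \<bar>(f (t + h) - f t) / h - D\<bar> < 1 / real (Suc k)"
    by auto
  obtain m where m: "1 / real (Suc m) < s" using s(1) nat_approx_posE by metis
  show "\<exists>m::nat. \<forall>r::rat. r \<noteq> 0 \<and> \<bar>real_of_rat r\<bar> < 1 / real (Suc m) \<longrightarrow>
      \<bar>(f (t + of_rat r) - f t) / of_rat r - D\<bar> \<le> 1 / real (Suc k)"
  proof (intro exI[of _ m] allI impI)
    fix r :: rat assume "r \<noteq> 0 \<and> \<bar>real_of_rat r\<bar> < 1 / real (Suc m)"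
    then show "\<bar>(f (t + of_rat r) - f t) / of_rat r - D\<bar> \<le> 1 / real (Suc k)"
      using s(2)[of "of_rat r"] m by simp
  qed
qed

text \<open>The nonstrict bound in \<open>rat_deriv\<close> survives limits of rational increments.
  The limit is taken on a punctured interval, since the quotient is singular at increment 0.\<close>

lemma rat_deriv_imp_has_derivative:
  assumes t: "t \<in> {a<..<b}" and cont: "continuous_on {a..b} f" and Q: "rat_deriv f t D"
  shows "(f has_real_derivative D) (at t)"
  unfolding DERIV_def
proof (rule LIM_I)
  fix e :: real assume "0 < e"
  then obtain k where k: "1 / real (Suc k) < e" using nat_approx_posE by metis
  obtain m :: nat where m: "\<And>r. r \<noteq> 0 \<Longrightarrow> \<bar>real_of_rat r\<bar> < 1 / real (Suc m) \<Longrightarrow>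
      \<bar>(f (t + of_rat r) - f t) / of_rat r - D\<bar> \<le> 1 / real (Suc k)"
    using Q unfolding rat_deriv_def by meson
  define s where "s = min (1 / real (Suc m)) (min (t - a) (b - t))"
  have s: "s > 0" using t by (auto simp: s_def)
  show "\<exists>s>0. \<forall>h. h \<noteq> 0 \<and> norm (h - 0) < s \<longrightarrow> norm ((f (t + h) - f t) / h - D) < e"
  proof (intro exI[of _ s] conjI allI impI s)
    fix h :: real assume h: "h \<noteq> 0 \<and> norm (h - 0) < s"
    have "\<bar>(f (t + h) - f t) / h - D\<bar> \<le> 1 / real (Suc k)"
    proof (rule le_on_rationals_imp_le[of "{-s<..<s} - {0}" h])
      show "open ({-s<..<s} - {0})" by (intro open_Diff) auto
      show "h \<in> {-s<..<s} - {0}" using h by auto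
      have "isCont f (t + h)"
        using h by (intro continuous_on_interior[OF cont]) (auto simp: s_def abs_if split: if_splits)
      then have "isCont (\<lambda>y. f (t + y)) h"
        using isCont_o2[of h "\<lambda>y. t + y" f] by simp
      then show "isCont (\<lambda>y. \<bar>(f (t + y) - f t) / y - D\<bar>) h"
        using h by (intro continuous_intros) auto
      fix r :: rat assume "of_rat r \<in> {-s<..<s} - {0}"
      then show "\<bar>(f (t + of_rat r) - f t) / of_rat r - D\<bar> \<le> 1 / real (Suc k)"
        by (intro m) (auto simp: s_def abs_if)
    qed
    then show "norm ((f (t + h) - f t) / h - D) < e" using k by simp
  qed
qed

text \<open>Swapping "almost every \<open>x\<close>" and "almost every \<open>t\<close>" needs a
  measurable condition. \<open>rat_deriv\<close> provides one: differentiability is weakened to it,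
  the quantifiers are exchanged, and continuity in \<open>t\<close> restores
  differentiability.\<close>

lemma jointly_measurable_derivative:
  assumes T: "t1 \<le> t2" and sf: "sigma_finite_measure nu"
    and p_meas: "(\<lambda>(x, t). p x t) \<in> borel_measurable (nu \<Otimes>\<^sub>M lborel)"
    and p_ac: "AE x in nu. abs_cont_on t1 t2 (p x)"
  obtains g where "(\<lambda>(x, t). g x t) \<in> borel_measurable (nu \<Otimes>\<^sub>M lborel)"
    "AE x in nu. AE t in lborel. t \<in> {t1<..<t2} \<longrightarrow> (p x has_real_derivative g x t) (at t)"
    "AE t in lborel. AE x in nu. t \<in> {t1<..<t2} \<longrightarrow> (p x has_real_derivative g x t) (at t)"
proof -
  interpret pair_sigma_finite nu lborel
    using sf by (simp add: pair_sigma_finite_def sigma_finite_lborel)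
  have shift [measurable]: "(\<lambda>z. p (fst z) (snd z + h)) \<in> borel_measurable (nu \<Otimes>\<^sub>M lborel)" for h
  proof -
    have "(\<lambda>z. (fst z, snd z + h)) \<in> nu \<Otimes>\<^sub>M lborel \<rightarrow>\<^sub>M nu \<Otimes>\<^sub>M lborel" by measurable
    from measurable_compose[OF this p_meas] show ?thesis by simp
  qed
  have [measurable]: "(\<lambda>z. p (fst z) (snd z)) \<in> borel_measurable (nu \<Otimes>\<^sub>M lborel)"
    using shift[of 0] by simp
  \<comment> \<open>Early quotients may use points beyond \<open>t2\<close>, but at interior
    \<open>t\<close> only the limit counts; where it fails to exist, \<open>g\<close> is a
    measurable default.\<close>
  define g where "g x t = lim (\<lambda>n. (p x (t + 1 / real (Suc n)) - p x t) / (1 / real (Suc n)))" for x t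
  have g_meas [measurable]: "(\<lambda>z. g (fst z) (snd z)) \<in> borel_measurable (nu \<Otimes>\<^sub>M lborel)"
    unfolding g_def by measurable
  have g: "g x t = D" if "(p x has_real_derivative D) (at t)" for x t D
  proof -
    have "((\<lambda>h. (p x (t + h) - p x t) / h) \<longlongrightarrow> D) (at 0)" using that by (simp add: DERIV_def)
    moreover have "filterlim (\<lambda>n. 1 / real (Suc n)) (at 0) sequentially"
      using lim_1_over_n[THEN LIMSEQ_Suc] by (auto simp: filterlim_at)
    ultimately show ?thesis unfolding g_def by (intro limI) (rule filterlim_compose)
  qed
  have x_t: "AE x in nu. AE t in lborel. t \<in> {t1<..<t2} \<longrightarrow> (p x has_real_derivative g x t) (at t)"
    using p_ac
  proof eventually_elim
    fix x assume "abs_cont_on t1 t2 (p x)"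
    from abs_cont_on_AE_differentiable[OF T this]
    show "AE t in lborel. t \<in> {t1<..<t2} \<longrightarrow> (p x has_real_derivative g x t) (at t)"
      by eventually_elim (use g in blast)
  qed
  have "AE x in nu. AE t in lborel. t \<in> {t1<..<t2} \<longrightarrow> rat_deriv (p x) t (g x t)"
    using x_t
  proof eventually_elim
    fix x assume "AE t in lborel. t \<in> {t1<..<t2} \<longrightarrow> (p x has_real_derivative g x t) (at t)"
    then show "AE t in lborel. t \<in> {t1<..<t2} \<longrightarrow> rat_deriv (p x) t (g x t)"
      by eventually_elim (use has_derivative_imp_rat_deriv in blast)
  qed
  then have "AE t in lborel. AE x in nu. t \<in> {t1<..<t2} \<longrightarrow> rat_deriv (p x) t (g x t)"
    by (subst (asm) AE_commute) (unfold rat_deriv_def, measurable)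
  then have t_x: "AE t in lborel. AE x in nu. t \<in> {t1<..<t2} \<longrightarrow> (p x has_real_derivative g x t) (at t)"
  proof eventually_elim
    fix t assume "AE x in nu. t \<in> {t1<..<t2} \<longrightarrow> rat_deriv (p x) t (g x t)"
    with p_ac show "AE x in nu. t \<in> {t1<..<t2} \<longrightarrow> (p x has_real_derivative g x t) (at t)"
      by eventually_elim (use rat_deriv_imp_has_derivative abs_cont_on_imp_continuous_on in blast)
  qed
  show thesis
    by (rule that[OF _ x_t t_x]) (use g_meas in \<open>simp add: case_prod_unfold\<close>)
qed

section \<open>The lower bound\<close>

text \<open>Comparison with the larger summand gives the factor \<open>2 powr q\<close>. A Bochner
  integral defaults to 0 without integrability, so this is what makes \<open>expect_t\<close> the
  true moment in the Hoelder bound.\<close>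

lemma integrable_powr_affine:
  fixes r w :: "'x \<Rightarrow> real"
  assumes q: "q > 1" and [measurable]: "r \<in> borel_measurable M"
    and w: "integrable M w" "\<And>x. x \<in> space M \<Longrightarrow> 0 \<le> w x"
    and r: "integrable M (\<lambda>x. \<bar>r x\<bar> powr q * w x)"
  shows "integrable M (\<lambda>x. \<bar>c + d * r x\<bar> powr q * w x)"
proof (rule Bochner_Integration.integrable_bound)
  have [measurable]: "w \<in> borel_measurable M" using w(1) by simp
  show "integrable M (\<lambda>x. 2 powr q * (\<bar>c\<bar> powr q * w x + \<bar>d\<bar> powr q * (\<bar>r x\<bar> powr q * w x)))"
    by (intro integrable_mult_right Bochner_Integration.integrable_add w r)
  show "(\<lambda>x. \<bar>c + d * r x\<bar> powr q * w x) \<in> borel_measurable M" by measurable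
  show "AE x in M. norm (\<bar>c + d * r x\<bar> powr q * w x) \<le>
    norm (2 powr q * (\<bar>c\<bar> powr q * w x + \<bar>d\<bar> powr q * (\<bar>r x\<bar> powr q * w x)))"
  proof (rule AE_I2)
    fix x assume x: "x \<in> space M"
    let ?m = "max \<bar>c\<bar> \<bar>d * r x\<bar>"
    have "\<bar>c + d * r x\<bar> powr q \<le> (2 * ?m) powr q"
      using q by (intro powr_mono2) auto
    also have "\<dots> = 2 powr q * ?m powr q" by (simp add: powr_mult)
    also have "\<dots> \<le> 2 powr q * (\<bar>c\<bar> powr q + \<bar>d * r x\<bar> powr q)"
      by (intro mult_left_mono) (auto simp: max_def)
    finally have "\<bar>c + d * r x\<bar> powr q * w x \<le> 2 powr q * (\<bar>c\<bar> powr q + \<bar>d * r x\<bar> powr q) * w x"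
      using w(2)[OF x] by (rule mult_right_mono)
    also have "\<dots> = 2 powr q * (\<bar>c\<bar> powr q * w x + \<bar>d\<bar> powr q * (\<bar>r x\<bar> powr q * w x))"
      by (simp add: abs_mult powr_mult algebra_simps)
    finally show "norm (\<bar>c + d * r x\<bar> powr q * w x) \<le>
        norm (2 powr q * (\<bar>c\<bar> powr q * w x + \<bar>d\<bar> powr q * (\<bar>r x\<bar> powr q * w x)))"
      using w(2)[OF x] by simp
  qed
qed

text \<open>The nondegenerate case for one admissible pair: \<open>s\<close> is a finite bound on
  the risk over the whole interval, and the Hoelder factor \<open>n\<close> is integrable.\<close>

lemma weighted_integral_bound:
  fixes nu :: "'x measure" and p :: "'x \<Rightarrow> real \<Rightarrow> real" and that :: "'x \<Rightarrow> real"
    and t1 t2 pp qq s :: real and a a' :: "real \<Rightarrow> real"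
  defines "n \<equiv> \<lambda>t. (expect_t nu p t (\<lambda>x. \<bar>a' t + a t * score p t1 t2 x t\<bar> powr qq)) powr (1 / qq)"
  assumes T: "t1 < t2"
    and sf: "sigma_finite_measure nu"
    and p_meas: "(\<lambda>(x, t). p x t) \<in> borel_measurable (nu \<Otimes>\<^sub>M lborel)"
    and p_nonneg: "\<And>x t. x \<in> space nu \<Longrightarrow> t \<in> {t1..t2} \<Longrightarrow> 0 \<le> p x t"
    and p_int: "\<And>t. t \<in> {t1..t2} \<Longrightarrow> integrable nu (\<lambda>x. p x t)"
    and p_one: "\<And>t. t \<in> {t1..t2} \<Longrightarrow> (\<integral>x. p x t \<partial>nu) = 1"
    and p_ac: "AE x in nu. abs_cont_on t1 t2 (p x)"
    and I_meas: "\<And>t. t \<in> {t1..t2} \<Longrightarrow> (\<lambda>x. (dt_dens p t1 t2 x t)\<^sup>2 / p x t) \<in> borel_measurable nu"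
    and pq: "pp > 1" "qq > 1" "1 / pp + 1 / qq = 1"
    and rho_fin: "\<And>t. t \<in> {t1..t2} \<Longrightarrow>
                  integrable nu (\<lambda>x. \<bar>score p t1 t2 x t\<bar> powr qq * p x t)"
    and that_meas [measurable]: "that \<in> borel_measurable nu"
    and a: "abs_cont_on t1 t2 a" "weak_deriv_on t1 t2 a a'" "a t1 = 0" "a t2 = 0"
    and n_int: "n integrable_on {t1..t2}"
    and s: "s \<ge> 0" "\<And>t. t \<in> {t1..t2} \<Longrightarrow>
      (\<integral>\<^sup>+ x. ennreal (\<bar>that x - t\<bar> powr pp * p x t) \<partial>nu) \<le> ennreal s"
  shows "\<bar>integral {t1..t2} a\<bar> \<le> s powr (1 / pp) * integral {t1..t2} n"
proof -
  interpret pair_sigma_finite nu lborel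
    using sf by (simp add: pair_sigma_finite_def sigma_finite_lborel)
  let ?J = "{t1<..<t2}"
  let ?K = "s powr (1 / pp) * integral {t1..t2} n"
  have p_sec [measurable]: "(\<lambda>x. p x t) \<in> borel_measurable nu" for t
    using measurable_compose[OF _ p_meas, of "\<lambda>x. (x, t)" nu] by simp
  have p_joint [measurable]: "(\<lambda>z. p (fst z) (snd z)) \<in> borel_measurable (nu \<Otimes>\<^sub>M lborel)"
    using p_meas by (simp add: case_prod_unfold)

  have holder: "(\<integral>\<^sup>+x. ennreal (\<bar>that x - t\<bar> * \<bar>a' t + a t * score p t1 t2 x t\<bar> * p x t) \<partial>nu)
      \<le> ennreal (s powr (1 / pp) * n t)" if t: "t \<in> {t1..t2}" for t
  proof -
    let ?v = "\<lambda>x. a' t + a t * score p t1 t2 x t"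
    have [measurable]: "(\<lambda>x. score p t1 t2 x t) \<in> borel_measurable nu"
      by (rule borel_measurable_score[OF T t p_sec I_meas[OF t]])
    have int: "integrable nu (\<lambda>x. \<bar>?v x\<bar> powr qq * p x t)"
      by (rule integrable_powr_affine[OF pq(2) _ p_int[OF t] p_nonneg[OF _ t] rho_fin[OF t]]) measurable
    have nonneg: "AE x in nu. 0 \<le> \<bar>?v x\<bar> powr qq * p x t"
      using p_nonneg[OF _ t] by (intro AE_I2) simp
    let ?E = "\<integral>x. \<bar>?v x\<bar> powr qq * p x t \<partial>nu"
    have "(\<integral>\<^sup>+x. ennreal (\<bar>that x - t\<bar> * \<bar>?v x\<bar> * p x t) \<partial>nu) \<le> ennreal (s powr (1 / pp) * ?E powr (1 / qq))"
    proof (rule weighted_Holder_nn_integral[OF pq _ _ p_sec p_nonneg[OF _ t] s(2)[OF t] s(1)])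
      show "(\<integral>\<^sup>+x. ennreal (\<bar>?v x\<bar> powr qq * p x t) \<partial>nu) \<le> ennreal ?E"
        using nn_integral_eq_integral[OF int nonneg] by simp
      show "0 \<le> ?E" using nonneg by (rule integral_nonneg_AE)
    qed measurable
    then show ?thesis by (simp add: n_def expect_t_def)
  qed

  obtain g where g_meas: "(\<lambda>(x, t). g x t) \<in> borel_measurable (nu \<Otimes>\<^sub>M lborel)"
    and g_xt: "AE x in nu. AE t in lborel. t \<in> ?J \<longrightarrow> (p x has_real_derivative g x t) (at t)"
    and g_tx: "AE t in lborel. AE x in nu. t \<in> ?J \<longrightarrow> (p x has_real_derivative g x t) (at t)"
    by (rule jointly_measurable_derivative[OF less_imp_le[OF T] sf p_meas p_ac], rule that)
  have [measurable]: "(\<lambda>z. g (fst z) (snd z)) \<in> borel_measurable (nu \<Otimes>\<^sub>M lborel)"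
    using g_meas by (simp add: case_prod_unfold)

  \<comment> \<open>Gauge integrability yields only Lebesgue measurability of \<open>a'\<close>; the
    Borel version \<open>b\<close> fits the product with \<open>lborel\<close>.\<close>
  have "(a' has_integral integral {t1..t2} a') {t1..t2}"
    using a(2) by (simp add: weak_deriv_on_def integrable_integral)
  then have "(\<lambda>t. indicator {t1..t2} t *\<^sub>R a' t) \<in> borel_measurable lebesgue"
    by (rule has_integral_implies_lebesgue_measurable)
  then obtain b where b_meas: "b \<in> borel_measurable lborel"
    and b: "AE t in lborel. indicator {t1..t2} t *\<^sub>R a' t = b t"
    using completion_ex_borel_measurable_real by blast
  have [measurable]: "b \<in> borel_measurable borel" using b_meas by simp
  \<comment> \<open>The cut-off makes \<open>A\<close> Borel on the line although \<open>a\<close>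
    is unconstrained outside the interval; the end points carry no mass.\<close>
  define A where "A t = indicator ?J t * a t" for t
  have a_cont: "continuous_on {t1..t2} a" by (rule abs_cont_on_imp_continuous_on[OF a(1)])
  have A_meas [measurable]: "A \<in> borel_measurable borel"
    using borel_measurable_continuous_on_indicator[of ?J a] continuous_on_subset[OF a_cont, of ?J]
    by (simp add: A_def[abs_def] greaterThanLessThan_subseteq_atLeastAtMost_iff)
  have A_int: "integrable lborel A"
  proof -
    obtain B where B: "\<And>t. t \<in> {t1..t2} \<Longrightarrow> \<bar>a t\<bar> \<le> B"
      using abs_cont_on_imp_bounded[OF a(1)] by blast
    have "\<bar>A t\<bar> \<le> B" if "t \<in> ?J" for t using B[of t] that by (simp add: A_def)
    then have "integrable lborel (\<lambda>t. indicator ?J t *\<^sub>R A t)"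
      by (intro integrableI_bounded_set_indicator[where B=B]) (use A_meas T in auto)
    moreover have "(\<lambda>t. indicator ?J t *\<^sub>R A t) = A" by (auto simp: A_def indicator_def)
    ultimately show ?thesis by simp
  qed
  have A_integral: "(\<integral>t. A t \<partial>lborel) = integral {t1..t2} a"
  proof -
    have "(A has_integral (\<integral>t. A t \<partial>lborel)) UNIV" by (rule has_integral_integral_lborel[OF A_int])
    moreover have "A = (\<lambda>t. if t \<in> ?J then a t else 0)" by (auto simp: A_def)
    ultimately have "(a has_integral (\<integral>t. A t \<partial>lborel)) ?J"
      by (simp only: has_integral_restrict_UNIV)
    then show ?thesis
      by (simp add: has_integral_Icc_iff_Ioo[symmetric] integral_unique)
  qed

  \<comment> \<open>Almost everywhere in \<open>?J\<close> the difference
    \<open>\<Phi> - \<Psi>\<close> is the derivative of \<open>(that x - t) * (a t * p x t)\<close>.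
    With \<open>g\<close> in place of score times density, \<open>\<Phi>\<close> is jointly
    measurable.\<close>
  define \<Phi> where "\<Phi> z = indicator ?J (snd z) * (that (fst z) - snd z) *
    (b (snd z) * p (fst z) (snd z) + A (snd z) * g (fst z) (snd z))" for z
  define \<Psi> where "\<Psi> z = A (snd z) * p (fst z) (snd z)" for z
  have [measurable]: "\<Phi> \<in> borel_measurable (nu \<Otimes>\<^sub>M lborel)" unfolding \<Phi>_def by measurable
  have [measurable]: "\<Psi> \<in> borel_measurable (nu \<Otimes>\<^sub>M lborel)" unfolding \<Psi>_def by measurable

  \<comment> \<open>Integrating over \<open>x\<close> first exposes the Hoelder estimate at fixed
    \<open>t\<close>; the bound also gives integrability of \<open>\<Phi>\<close>.\<close>
  have \<Phi>_bound: "(\<integral>\<^sup>+z. ennreal (norm (\<Phi> z)) \<partial>(nu \<Otimes>\<^sub>M lborel)) \<le> ennreal ?K"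
  proof -
    have "(\<integral>\<^sup>+z. ennreal (norm (\<Phi> z)) \<partial>(nu \<Otimes>\<^sub>M lborel)) = (\<integral>\<^sup>+t. \<integral>\<^sup>+x. ennreal (norm (\<Phi> (x, t))) \<partial>nu \<partial>lborel)"
      by (rule nn_integral_snd[symmetric]) measurable
    also have "\<dots> \<le> (\<integral>\<^sup>+t. ennreal (s powr (1 / pp) * n t) * indicator {t1..t2} t \<partial>lborel)"
    proof (rule nn_integral_mono_AE)
      show "AE t in lborel. (\<integral>\<^sup>+x. ennreal (norm (\<Phi> (x, t))) \<partial>nu) \<le> ennreal (s powr (1 / pp) * n t) * indicator {t1..t2} t"
        using g_tx b
      proof eventually_elim
        fix t assume g: "AE x in nu. t \<in> ?J \<longrightarrow> (p x has_real_derivative g x t) (at t)"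
          and b: "indicator {t1..t2} t *\<^sub>R a' t = b t"
        show "(\<integral>\<^sup>+x. ennreal (norm (\<Phi> (x, t))) \<partial>nu) \<le> ennreal (s powr (1 / pp) * n t) * indicator {t1..t2} t"
        proof (cases "t \<in> ?J")
          case True
          then have t: "t \<in> {t1..t2}" by auto
          have "(\<integral>\<^sup>+x. ennreal (norm (\<Phi> (x, t))) \<partial>nu) =
            (\<integral>\<^sup>+x. ennreal (\<bar>that x - t\<bar> * \<bar>a' t + a t * score p t1 t2 x t\<bar> * p x t) \<partial>nu)"
          proof (rule nn_integral_cong_AE)
            show "AE x in nu. ennreal (norm (\<Phi> (x, t))) =
              ennreal (\<bar>that x - t\<bar> * \<bar>a' t + a t * score p t1 t2 x t\<bar> * p x t)"
              using g AE_space
            proof eventually_elim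
              fix x assume g: "t \<in> ?J \<longrightarrow> (p x has_real_derivative g x t) (at t)" and x: "x \<in> space nu"
              have gs: "g x t = score p t1 t2 x t * p x t"
                using score_mult_density[of t t1 t2 p x "g x t"] g True p_nonneg[OF x] by auto
              have "\<Phi> (x, t) = (that x - t) * (a' t + a t * score p t1 t2 x t) * p x t"
                using True t b by (simp add: \<Phi>_def A_def gs algebra_simps)
              then show "ennreal (norm (\<Phi> (x, t))) =
                  ennreal (\<bar>that x - t\<bar> * \<bar>a' t + a t * score p t1 t2 x t\<bar> * p x t)"
                using p_nonneg[OF x t] by (simp add: abs_mult)
            qed
          qed
          then show ?thesis using holder[OF t] t by simp
        next
          case False
          then show ?thesis by (simp add: \<Phi>_def)
        qed
      qed
    qed
    also have "\<dots> = ennreal ?K"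
    proof (rule nn_integral_has_integral_lebesgue')
      show "((\<lambda>t. s powr (1 / pp) * n t) has_integral ?K) {t1..t2}"
        by (intro has_integral_mult_right integrable_integral n_int)
    qed (simp add: n_def)
    finally show ?thesis .
  qed
  have \<Phi>_int: "integrable (nu \<Otimes>\<^sub>M lborel) \<Phi>"
    using \<Phi>_bound by (intro integrableI_bounded) (auto intro: le_less_trans)

  have \<Psi>_int: "integrable (nu \<Otimes>\<^sub>M lborel) \<Psi>"
  proof (rule integrableI_bounded)
    have "(\<integral>\<^sup>+z. ennreal (norm (\<Psi> z)) \<partial>(nu \<Otimes>\<^sub>M lborel)) = (\<integral>\<^sup>+t. \<integral>\<^sup>+x. ennreal (norm (\<Psi> (x, t))) \<partial>nu \<partial>lborel)"
      by (rule nn_integral_snd[symmetric]) measurable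
    also have "\<dots> = (\<integral>\<^sup>+t. ennreal (norm (A t)) \<partial>lborel)"
    proof (rule nn_integral_cong)
      fix t
      show "(\<integral>\<^sup>+x. ennreal (norm (\<Psi> (x, t))) \<partial>nu) = ennreal (norm (A t))"
      proof (cases "t \<in> ?J")
        case True
        then have t: "t \<in> {t1..t2}" by auto
        have "(\<integral>\<^sup>+x. ennreal (norm (\<Psi> (x, t))) \<partial>nu) = (\<integral>\<^sup>+x. ennreal \<bar>A t\<bar> * ennreal (p x t) \<partial>nu)"
          using p_nonneg[OF _ t] by (intro nn_integral_cong) (simp add: \<Psi>_def abs_mult ennreal_mult)
        also have "\<dots> = ennreal \<bar>A t\<bar> * ennreal 1"
          using nn_integral_eq_integral[OF p_int[OF t] AE_I2[OF p_nonneg[OF _ t]]] p_one[OF t]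
          by (simp add: nn_integral_cmult)
        finally show ?thesis by simp
      next
        case False
        then show ?thesis by (simp add: \<Psi>_def A_def)
      qed
    qed
    also have "\<dots> < \<infinity>" using A_int by (simp add: integrable_iff_bounded)
    finally show "(\<integral>\<^sup>+z. ennreal (norm (\<Psi> z)) \<partial>(nu \<Otimes>\<^sub>M lborel)) < \<infinity>" .
  qed measurable

  have "(\<integral>z. \<Psi> z \<partial>(nu \<Otimes>\<^sub>M lborel)) = (\<integral>t. (\<integral>x. \<Psi> (x, t) \<partial>nu) \<partial>lborel)"
    using integral_snd[of "\<lambda>x t. \<Psi> (x, t)"] \<Psi>_int by simp
  also have "\<dots> = (\<integral>t. A t \<partial>lborel)"
  proof (rule Bochner_Integration.integral_cong[OF refl])
    fix t
    show "(\<integral>x. \<Psi> (x, t) \<partial>nu) = A t"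
      using p_one[of t] by (cases "t \<in> ?J") (auto simp: \<Psi>_def A_def)
  qed
  finally have \<Psi>_integral: "(\<integral>z. \<Psi> z \<partial>(nu \<Otimes>\<^sub>M lborel)) = integral {t1..t2} a"
    using A_integral by simp

  \<comment> \<open>Here \<open>t\<close> is integrated first: \<open>a\<close> vanishes at both
    ends, so for almost every \<open>x\<close> the derivative integrates to 0.\<close>
  have "AE x in nu. (\<integral>t. \<Phi> (x, t) \<partial>lborel) = (\<integral>t. \<Psi> (x, t) \<partial>lborel)"
    using p_ac g_xt AE_integrable_fst'[OF \<Phi>_int] AE_integrable_fst'[OF \<Psi>_int]
  proof eventually_elim
    fix x assume ac: "abs_cont_on t1 t2 (p x)"
      and g: "AE t in lborel. t \<in> ?J \<longrightarrow> (p x has_real_derivative g x t) (at t)"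
      and int: "integrable lborel (\<lambda>t. \<Phi> (x, t))" "integrable lborel (\<lambda>t. \<Psi> (x, t))"
    let ?u = "\<lambda>t. (that x - t) * (a t * p x t)"
    have "((\<lambda>t. \<Phi> (x, t) - \<Psi> (x, t)) has_integral (?u t2 - ?u t1)) {t1..t2}"
    proof (rule abs_cont_on_has_integral_derivative[OF less_imp_le[OF T]])
      show "abs_cont_on t1 t2 ?u"
        by (intro abs_cont_on_mult abs_cont_on_const_minus_ident a(1) ac)
      show "AE t in lborel. t \<in> ?J \<longrightarrow> (?u has_real_derivative \<Phi> (x, t) - \<Psi> (x, t)) (at t)"
        using g b weak_deriv_on_AE_derivative[OF a(2)]
      proof eventually_elim
        fix t assume g: "t \<in> ?J \<longrightarrow> (p x has_real_derivative g x t) (at t)"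
          and b: "indicator {t1..t2} t *\<^sub>R a' t = b t"
          and a': "t \<in> ?J \<longrightarrow> (a has_real_derivative a' t) (at t)"
        show "t \<in> ?J \<longrightarrow> (?u has_real_derivative \<Phi> (x, t) - \<Psi> (x, t)) (at t)"
        proof
          assume t: "t \<in> ?J"
          have "(?u has_real_derivative (0 - 1) * (a t * p x t) + (a' t * p x t + g x t * a t) * (that x - t)) (at t)"
            using g a' t by (intro DERIV_mult DERIV_diff DERIV_const DERIV_ident) auto
          moreover have "(0 - 1) * (a t * p x t) + (a' t * p x t + g x t * a t) * (that x - t) = \<Phi> (x, t) - \<Psi> (x, t)"
            using b t by (simp add: \<Phi>_def \<Psi>_def A_def algebra_simps)
          ultimately show "(?u has_real_derivative \<Phi> (x, t) - \<Psi> (x, t)) (at t)" by simp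
        qed
      qed
    qed
    then have "((\<lambda>t. \<Phi> (x, t) - \<Psi> (x, t)) has_integral 0) {t1..t2}"
      using a(3,4) by simp
    then have "((\<lambda>t. \<Phi> (x, t) - \<Psi> (x, t)) has_integral 0) UNIV"
      by (rule has_integral_on_superset) (auto simp: \<Phi>_def \<Psi>_def A_def indicator_def)
    moreover have "((\<lambda>t. \<Phi> (x, t) - \<Psi> (x, t)) has_integral (\<integral>t. \<Phi> (x, t) - \<Psi> (x, t) \<partial>lborel)) UNIV"
      by (intro has_integral_integral_lborel Bochner_Integration.integrable_diff int)
    ultimately have "(\<integral>t. \<Phi> (x, t) - \<Psi> (x, t) \<partial>lborel) = 0"
      using has_integral_unique by blast
    then show "(\<integral>t. \<Phi> (x, t) \<partial>lborel) = (\<integral>t. \<Psi> (x, t) \<partial>lborel)"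
      using int by simp
  qed
  then have "(\<integral>x. (\<integral>t. \<Phi> (x, t) \<partial>lborel) \<partial>nu) = (\<integral>x. (\<integral>t. \<Psi> (x, t) \<partial>lborel) \<partial>nu)"
    using integrable_fst'[OF \<Phi>_int] integrable_fst'[OF \<Psi>_int]
    by (intro integral_cong_AE) auto
  then have "(\<integral>z. \<Phi> z \<partial>(nu \<Otimes>\<^sub>M lborel)) = integral {t1..t2} a"
    using integral_fst'[OF \<Phi>_int] integral_fst'[OF \<Psi>_int] \<Psi>_integral by simp
  then have "ennreal \<bar>integral {t1..t2} a\<bar> \<le> ennreal ?K"
    using order_trans[OF integral_norm_bound_ennreal[OF \<Phi>_int] \<Phi>_bound] by simp
  moreover have "0 \<le> ?K"
    by (intro mult_nonneg_nonneg Henstock_Kurzweil_Integration.integral_nonneg n_int) (auto simp: n_def)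
  ultimately show ?thesis by simp
qed

section \<open>From single admissible pairs to the suprema\<close>

theorem theorem3:
  fixes nu :: "'x measure" and p :: "'x \<Rightarrow> real \<Rightarrow> real"
    and t1 t2 pp qq :: real and that :: "'x \<Rightarrow> real"
  assumes T: "t1 < t2"
    and sf: "sigma_finite_measure nu"
    and p_meas: "(\<lambda>(x, t). p x t) \<in> borel_measurable (nu \<Otimes>\<^sub>M lborel)"
    and p_nonneg: "\<And>x t. x \<in> space nu \<Longrightarrow> t \<in> {t1..t2} \<Longrightarrow> 0 \<le> p x t"
    and p_int: "\<And>t. t \<in> {t1..t2} \<Longrightarrow> integrable nu (\<lambda>x. p x t)"
    and p_one: "\<And>t. t \<in> {t1..t2} \<Longrightarrow> (\<integral>x. p x t \<partial>nu) = 1"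
    and p_ac: "AE x in nu. abs_cont_on t1 t2 (p x)"
    and I_fin: "\<And>t. t \<in> {t1..t2} \<Longrightarrow>
                  integrable nu (\<lambda>x. (dt_dens p t1 t2 x t)\<^sup>2 / p x t)"
    and I_int: "fisher_info nu p t1 t2 integrable_on {t1..t2}"
    and I_ac: "abs_cont_on t1 t2 (fisher_info nu p t1 t2)"
    and pq: "pp > 1" "qq > 1" "1 / pp + 1 / qq = 1"
    and rho_fin: "\<And>t. t \<in> {t1..t2} \<Longrightarrow>
                  integrable nu (\<lambda>x. \<bar>score p t1 t2 x t\<bar> powr qq * p x t)"
    and rho_int: "(\<lambda>t. expect_t nu p t (\<lambda>x. \<bar>score p t1 t2 x t\<bar> powr qq))
                    integrable_on {t1..t2}"
    and that_meas: "that \<in> borel_measurable nu"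
  shows "(SUP t\<in>{t1..t2}. \<integral>\<^sup>+ x. ennreal (\<bar>that x - t\<bar> powr pp * p x t) \<partial>nu)
         \<ge> (SUP (a, a')\<in>adm_class t1 t2.
              ennreal ((\<bar>integral {t1..t2} a\<bar> /
                 integral {t1..t2} (\<lambda>t. (expect_t nu p t
                    (\<lambda>x. \<bar>a' t + a t * score p t1 t2 x t\<bar> powr qq)) powr (1 / qq))) powr pp))"
proof (rule SUP_least, clarify)
  fix a a' assume "(a, a') \<in> adm_class t1 t2"
  then have a: "abs_cont_on t1 t2 a" "weak_deriv_on t1 t2 a a'" "a t1 = 0" "a t2 = 0"
    by (auto simp: adm_class_def)
  let ?S = "SUP t\<in>{t1..t2}. \<integral>\<^sup>+ x. ennreal (\<bar>that x - t\<bar> powr pp * p x t) \<partial>nu"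
  let ?n = "\<lambda>t. (expect_t nu p t (\<lambda>x. \<bar>a' t + a t * score p t1 t2 x t\<bar> powr qq)) powr (1 / qq)"
  let ?N = "integral {t1..t2} ?n"
  show "ennreal ((\<bar>integral {t1..t2} a\<bar> / ?N) powr pp) \<le> ?S"
  \<comment> \<open>An infinite risk is trivial. \<open>?N = 0\<close> also absorbs a nonintegrable
    \<open>?n\<close>, whose integral defaults to 0; division by 0 then makes the bound 0.
    Conversely, a nonzero \<open>?N\<close> certifies integrability.\<close>
  proof (cases "?S = top \<or> ?N = 0")
    case True
    then show ?thesis
    proof
      assume "?S = top"
      then show ?thesis by (simp only: top_greatest)
    next
      assume "?N = 0"
      then show ?thesis by (simp only: div_by_0) simp
    qed
  next
    case False
    then have n_int: "?n integrable_on {t1..t2}" using not_integrable_integral by blast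
    have "?N \<ge> 0" by (rule Henstock_Kurzweil_Integration.integral_nonneg[OF n_int]) simp
    then have N: "?N > 0" using False by simp
    define s where "s = enn2real ?S"
    have "?S < top" using False unfolding less_top[symmetric] by blast
    then have S: "?S = ennreal s" unfolding s_def by (rule ennreal_enn2real[symmetric])
    have s: "s \<ge> 0" by (simp add: s_def)
    have s_upper: "(\<integral>\<^sup>+ x. ennreal (\<bar>that x - t\<bar> powr pp * p x t) \<partial>nu) \<le> ennreal s"
      if "t \<in> {t1..t2}" for t
      unfolding S[symmetric] using that by (rule SUP_upper)
    have "\<bar>integral {t1..t2} a\<bar> \<le> s powr (1 / pp) * ?N"
      by (rule weighted_integral_bound[OF T sf p_meas p_nonneg p_int p_one p_ac
            borel_measurable_integrable[OF I_fin] pq rho_fin that_meas a n_int s s_upper])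
    then have "\<bar>integral {t1..t2} a\<bar> / ?N \<le> s powr (1 / pp)" using N by (simp add: divide_le_eq)
    then have "(\<bar>integral {t1..t2} a\<bar> / ?N) powr pp \<le> (s powr (1 / pp)) powr pp"
      using pq N by (intro powr_mono2) auto
    also have "\<dots> = s" using pq s by (simp add: powr_powr)
    finally show ?thesis unfolding S by (rule ennreal_leI)
  qed
qed

end
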